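(* Let $R$ be a ring, $M$ a nonzero uniformly finite $R$-module, $N$ a submodule of $M$ with $N\neq M$, and $\pi:M\to M/N$, $m\mapsto m+N$. The maximal shortest uniform decompositions of $N$ in $M$ are precisely the decompositions $N=C_1\cap\cdots\cap C_n$ obtained as follows: take uniform submodules $U_1,\ldots,U_n$ of $M/N$ whose sum is direct and such that $U_1\oplus\cdots\oplus U_n$ is an essential submodule of $M/N$; for each $i=1,\ldots,n$ take a complement $\overline{C}_i$ to $U_i$ in $M/N$ that contains the modules $U_j$, $j\neq i$; and set $C_i:=\pi^{-1}(\overline{C}_i)$.
   Context: Rings have $1$ and need not be commutative; module means left module. A submodule $N$ of $M$ is essential if $N\cap L\neq 0$ for every nonzero submodule $L$ of $M$. A module $U$ is uniform if $U\neq 0$ and every nonzero submodule of $U$ is essential in $U$. A module has finite uniform dimension if it contains no infinite direct sum of nonzero submodules; then $\operatorname{u.dim}(M)$ is the number of summands in any essential direct sum of uniform submodules of $M$ ($0$ if $M=0$). An $R$-module $M$ is uniformly finite if every factor module of $M$ has finite uniform dimension. A uniform decomposition of $N$ in $M$ is an expression $N=N_1\cap\cdots\cap N_s$ ($s\geq 1$ finite) with submodules $N_i$ of $M$ such that each $M/N_i$ is a uniform module; it is shortest if $s=\operatorname{u.dim}(M/N)$. A shortest uniform decomposition $N=N_1\cap\cdots\cap N_n$ is maximal if, whenever $N=N_1'\cap\cdots\cap N_n'$ is a shortest uniform decomposition of $N$ in $M$ with $N_i\subseteq N_i'$ for all $i$, then $N_i=N_i'$ for all $i$. A complement to a submodule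 $A$ in a module $Q$ is a submodule $C$ of $Q$ that is maximal with respect to the property $A\cap C=0$. *)

theory Defs
  imports "HOL-Algebra.Module" "HOL-Algebra.AbelCoset"
begin

text \<open>
  The locale \<^locale>\<open>module\<close> of HOL-Algebra requires a commutative ring of scalars.
  Unital left modules over an arbitrary ring are obtained by replacing \<^locale>\<open>cring\<close> by
  \<^locale>\<open>ring\<close>.  The locale \<^locale>\<open>submodule\<close> makes no assumption on the scalars
  and is used as it is.
\<close>

locale left_module = R?: ring R + M?: abelian_group M
  for R :: "('a, 'r) ring_scheme" (structure) and M :: "('a, 'b, 'm) module_scheme" (structure) +
  assumes smult_closed [simp, intro]:
      "\<lbrakk>a \<in> carrier R; x \<in> carrier M\<rbrakk> \<Longrightarrow> a \<odot>\<^bsub>M\<^esub> x \<in> carrier M"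
    and smult_l_distr:
      "\<lbrakk>a \<in> carrier R; b \<in> carrier R; x \<in> carrier M\<rbrakk>
        \<Longrightarrow> (a \<oplus> b) \<odot>\<^bsub>M\<^esub> x = a \<odot>\<^bsub>M\<^esub> x \<oplus>\<^bsub>M\<^esub> b \<odot>\<^bsub>M\<^esub> x"
    and smult_r_distr:
      "\<lbrakk>a \<in> carrier R; x \<in> carrier M; y \<in> carrier M\<rbrakk>
        \<Longrightarrow> a \<odot>\<^bsub>M\<^esub> (x \<oplus>\<^bsub>M\<^esub> y) = a \<odot>\<^bsub>M\<^esub> x \<oplus>\<^bsub>M\<^esub> a \<odot>\<^bsub>M\<^esub> y"
    and smult_assoc1:
      "\<lbrakk>a \<in> carrier R; b \<in> carrier R; x \<in> carrier M\<rbrakk>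
        \<Longrightarrow> (a \<otimes> b) \<odot>\<^bsub>M\<^esub> x = a \<odot>\<^bsub>M\<^esub> (b \<odot>\<^bsub>M\<^esub> x)"
    and smult_one [simp]:
      "x \<in> carrier M \<Longrightarrow> \<one> \<odot>\<^bsub>M\<^esub> x = x"

text \<open>
  The elements of the factor module are the cosets of \<open>N\<close>.  The fields \<open>mult\<close> and \<open>one\<close> are
  only present because the record of modules extends that of rings.
\<close>

definition factor_module :: "('a, 'b, 'm) module_scheme \<Rightarrow> 'b set \<Rightarrow> ('a, 'b set) module"
  where "factor_module M N =
    \<lparr>carrier = a_rcosets\<^bsub>M\<^esub> N, mult = undefined, one = undefined,
     zero = N, add = set_add M, smult = (\<lambda>a A. \<Union>x\<in>A. N +>\<^bsub>M\<^esub> (a \<odot>\<^bsub>M\<^esub> x))\<rparr>"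

definition essential_submodule :: "('a, 'r) ring_scheme \<Rightarrow> ('a, 'b, 'm) module_scheme \<Rightarrow> 'b set \<Rightarrow> bool"
  where "essential_submodule R M N \<longleftrightarrow>
    submodule N R M \<and> (\<forall>L. submodule L R M \<and> L \<noteq> {\<zero>\<^bsub>M\<^esub>} \<longrightarrow> N \<inter> L \<noteq> {\<zero>\<^bsub>M\<^esub>})"

definition uniform_module :: "('a, 'r) ring_scheme \<Rightarrow> ('a, 'b, 'm) module_scheme \<Rightarrow> bool"
  where "uniform_module R M \<longleftrightarrow>
    carrier M \<noteq> {\<zero>\<^bsub>M\<^esub>} \<and>
    (\<forall>L. submodule L R M \<and> L \<noteq> {\<zero>\<^bsub>M\<^esub>} \<longrightarrow> essential_submodule R M L)"

definition uniform_submodule :: "('a, 'r) ring_scheme \<Rightarrow> ('a, 'b, 'm) module_scheme \<Rightarrow> 'b set \<Rightarrow> bool"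
  where "uniform_submodule R M U \<longleftrightarrow> submodule U R M \<and> uniform_module R (M\<lparr>carrier := U\<rparr>)"

text \<open>The sum of a family of submodules is the smallest submodule containing all of them.\<close>

definition submodule_sum ::
    "('a, 'r) ring_scheme \<Rightarrow> ('a, 'b, 'm) module_scheme \<Rightarrow> 'i set \<Rightarrow> ('i \<Rightarrow> 'b set) \<Rightarrow> 'b set"
  where "submodule_sum R M I K = \<Inter>{S. submodule S R M \<and> (\<forall>i\<in>I. K i \<subseteq> S)}"

definition direct_sum_family ::
    "('a, 'r) ring_scheme \<Rightarrow> ('a, 'b, 'm) module_scheme \<Rightarrow> 'i set \<Rightarrow> ('i \<Rightarrow> 'b set) \<Rightarrow> bool"
  where "direct_sum_family R M I K \<longleftrightarrow>
    (\<forall>i\<in>I. submodule (K i) R M) \<and>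
    (\<forall>i\<in>I. K i \<inter> submodule_sum R M (I - {i}) K = {\<zero>\<^bsub>M\<^esub>})"

text \<open>
  In a direct sum of nonzero submodules the summands are pairwise distinct, so that it suffices to
  consider families indexed by themselves, that is, sets of submodules.
\<close>

definition finite_uniform_dimension :: "('a, 'r) ring_scheme \<Rightarrow> ('a, 'b, 'm) module_scheme \<Rightarrow> bool"
  where "finite_uniform_dimension R M \<longleftrightarrow>
    \<not> (\<exists>\<K>. infinite \<K> \<and> (\<forall>K\<in>\<K>. K \<noteq> {\<zero>\<^bsub>M\<^esub>}) \<and> direct_sum_family R M \<K> (\<lambda>K. K))"

definition essential_uniform_sum ::
    "('a, 'r) ring_scheme \<Rightarrow> ('a, 'b, 'm) module_scheme \<Rightarrow> nat \<Rightarrow> (nat \<Rightarrow> 'b set) \<Rightarrow> bool"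
  where "essential_uniform_sum R M n U \<longleftrightarrow>
    (\<forall>i<n. uniform_submodule R M (U i)) \<and>
    direct_sum_family R M {..<n} U \<and>
    essential_submodule R M (submodule_sum R M {..<n} U)"

text \<open>
  Only meaningful for modules of finite uniform dimension.  For the zero module the empty
  sum (\<open>n = 0\<close>) is the only one possible.
\<close>

definition udim :: "('a, 'r) ring_scheme \<Rightarrow> ('a, 'b, 'm) module_scheme \<Rightarrow> nat"
  where "udim R M = (THE n. \<exists>U. essential_uniform_sum R M n U)"

definition uniformly_finite :: "('a, 'r) ring_scheme \<Rightarrow> ('a, 'b, 'm) module_scheme \<Rightarrow> bool"
  where "uniformly_finite R M \<longleftrightarrow>
    (\<forall>N. submodule N R M \<longrightarrow> finite_uniform_dimension R (factor_module M N))"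

text \<open>
  A decomposition with \<open>n\<close> components is a function on \<^typ>\<open>nat\<close> of which only the values at
  \<open>0, \<dots>, n - 1\<close> matter.
\<close>

definition uniform_decomposition ::
    "('a, 'r) ring_scheme \<Rightarrow> ('a, 'b, 'm) module_scheme \<Rightarrow> 'b set \<Rightarrow> nat \<Rightarrow> (nat \<Rightarrow> 'b set) \<Rightarrow> bool"
  where "uniform_decomposition R M N n C \<longleftrightarrow>
    1 \<le> n \<and>
    (\<forall>i<n. submodule (C i) R M \<and> uniform_module R (factor_module M (C i))) \<and>
    N = (\<Inter>i<n. C i)"

definition shortest_uniform_decomposition ::
    "('a, 'r) ring_scheme \<Rightarrow> ('a, 'b, 'm) module_scheme \<Rightarrow> 'b set \<Rightarrow> nat \<Rightarrow> (nat \<Rightarrow> 'b set) \<Rightarrow> bool"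
  where "shortest_uniform_decomposition R M N n C \<longleftrightarrow>
    uniform_decomposition R M N n C \<and> n = udim R (factor_module M N)"

definition maximal_shortest_uniform_decomposition ::
    "('a, 'r) ring_scheme \<Rightarrow> ('a, 'b, 'm) module_scheme \<Rightarrow> 'b set \<Rightarrow> nat \<Rightarrow> (nat \<Rightarrow> 'b set) \<Rightarrow> bool"
  where "maximal_shortest_uniform_decomposition R M N n C \<longleftrightarrow>
    shortest_uniform_decomposition R M N n C \<and>
    (\<forall>C'. shortest_uniform_decomposition R M N n C' \<and> (\<forall>i<n. C i \<subseteq> C' i)
       \<longrightarrow> (\<forall>i<n. C i = C' i))"

definition complement_to ::
    "('a, 'r) ring_scheme \<Rightarrow> ('a, 'b, 'm) module_scheme \<Rightarrow> 'b set \<Rightarrow> 'b set \<Rightarrow> bool"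
  where "complement_to R Q A C \<longleftrightarrow>
    submodule C R Q \<and> A \<inter> C = {\<zero>\<^bsub>Q\<^esub>} \<and>
    (\<forall>C'. submodule C' R Q \<and> A \<inter> C' = {\<zero>\<^bsub>Q\<^esub>} \<and> C \<subseteq> C' \<longrightarrow> C' = C)"

end

theory Submission
  imports Defs
begin

text \<open>
  Pass to \<open>Q = M/N\<close>: decompositions of \<open>N\<close> into submodules with uniform factor module correspond to
  decompositions \<open>0 = D\<^sub>1 \<inter> \<dots> \<inter> D\<^sub>n\<close> into meet-irreducible submodules of \<open>Q\<close>.

  If \<open>U\<^sub>1, \<dots>, U\<^sub>n\<close> are nonzero, \<open>U\<^sub>i \<inter> D\<^sub>i = 0\<close> and \<open>U\<^sub>j \<subseteq> D\<^sub>i\<close> for \<open>j \<noteq> i\<close>, then the \<open>U\<^sub>i\<close> are uniform,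
  their sum is direct, and it is essential because it contains the intersection of the essential
  submodules \<open>U\<^sub>i + D\<^sub>i\<close>.  Hence an irredundant decomposition, with \<open>U\<^sub>i = \<Inter>\<^sub>j\<^sub>\<noteq>\<^sub>i D\<^sub>j\<close>, has exactly
  \<open>u.dim Q\<close> components, and so a shortest decomposition is irredundant.  Enlarging each \<open>D\<^sub>i\<close> to a
  complement of \<open>U\<^sub>i\<close> gives a shortest decomposition again, which is the given one if that is
  maximal.  Conversely, if the \<open>D\<^sub>i\<close> are complements, a proper enlargement of \<open>D\<^sub>i\<close> meets \<open>U\<^sub>i\<close>
  nontrivially, and \<open>U\<^sub>i\<close> lies in all the other components.
\<close>


subsection \<open>Submodules of a left module\<close>

context left_module
begin

lemma smult_zero_left [simp]:
  assumes "x \<in> carrier M"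
  shows "\<zero> \<odot>\<^bsub>M\<^esub> x = \<zero>\<^bsub>M\<^esub>"
proof -
  have "\<zero> \<odot>\<^bsub>M\<^esub> x \<oplus>\<^bsub>M\<^esub> \<zero> \<odot>\<^bsub>M\<^esub> x = \<zero> \<odot>\<^bsub>M\<^esub> x"
    using assms smult_l_distr[of \<zero> \<zero> x] by simp
  then show ?thesis
    using assms M.add.l_cancel_one[of "\<zero> \<odot>\<^bsub>M\<^esub> x" "\<zero> \<odot>\<^bsub>M\<^esub> x"] by simp
qed

lemma smult_minus_one:
  assumes "x \<in> carrier M"
  shows "(\<ominus> \<one>) \<odot>\<^bsub>M\<^esub> x = \<ominus>\<^bsub>M\<^esub> x"
proof -
  have "(\<ominus> \<one>) \<odot>\<^bsub>M\<^esub> x \<oplus>\<^bsub>M\<^esub> x = (\<ominus> \<one> \<oplus> \<one>) \<odot>\<^bsub>M\<^esub> x"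
    using assms smult_l_distr[of "\<ominus> \<one>" \<one> x] by simp
  also have "\<dots> = \<zero>\<^bsub>M\<^esub>"
    using assms by (simp add: R.l_neg)
  finally show ?thesis
    using assms M.minus_equality[of "(\<ominus> \<one>) \<odot>\<^bsub>M\<^esub> x" x] by simp
qed

text \<open>Closure under negatives, which the subgroup part of \<open>submodule\<close> demands,
  comes for free: in a unital module it is the action of the scalar -1.\<close>

lemma submodule_iff:
  "submodule S R M \<longleftrightarrow>
    S \<subseteq> carrier M \<and> \<zero>\<^bsub>M\<^esub> \<in> S \<and> (\<forall>x\<in>S. \<forall>y\<in>S. x \<oplus>\<^bsub>M\<^esub> y \<in> S) \<and>
    (\<forall>a\<in>carrier R. \<forall>x\<in>S. a \<odot>\<^bsub>M\<^esub> x \<in> S)"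
    (is "_ \<longleftrightarrow> ?rhs")
proof
  assume S: "submodule S R M"
  then interpret S: submodule S R M .
  show ?rhs
    using S.subset S.m_closed S.one_closed S.smult_closed by auto
next
  assume S: ?rhs
  have "\<ominus>\<^bsub>M\<^esub> x \<in> S" if "x \<in> S" for x
  proof -
    have "x \<in> carrier M"
      using S that by blast
    moreover have "(\<ominus> \<one>) \<odot>\<^bsub>M\<^esub> x \<in> S"
      using S that by simp
    ultimately show ?thesis
      by (simp add: smult_minus_one)
  qed
  then show "submodule S R M"
    using S by (intro submodule.intro subgroup.intro submodule_axioms.intro)
      (auto simp flip: a_inv_def)
qed

lemma
  assumes "submodule S R M"
  shows submodule_subset: "S \<subseteq> carrier M"
    and submodule_carrier: "x \<in> S \<Longrightarrow> x \<in> carrier M"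
    and submodule_zero: "\<zero>\<^bsub>M\<^esub> \<in> S"
    and submodule_add: "\<lbrakk>x \<in> S; y \<in> S\<rbrakk> \<Longrightarrow> x \<oplus>\<^bsub>M\<^esub> y \<in> S"
    and submodule_smult: "\<lbrakk>a \<in> carrier R; x \<in> S\<rbrakk> \<Longrightarrow> a \<odot>\<^bsub>M\<^esub> x \<in> S"
  using assms unfolding submodule_iff by auto

lemma submodule_neg:
  assumes "submodule S R M" "x \<in> S"
  shows "\<ominus>\<^bsub>M\<^esub> x \<in> S"
  using assms submodule_smult[of S "\<ominus> \<one>" x] smult_minus_one submodule_carrier by auto

lemma submodule_diff:
  assumes "submodule S R M" "x \<in> S" "y \<in> S"
  shows "x \<ominus>\<^bsub>M\<^esub> y \<in> S"
  using assms by (simp add: a_minus_def submodule_add submodule_neg)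

lemma submodule_add_cancel:
  assumes "submodule S R M" "x \<in> S" "y \<in> carrier M" "x \<oplus>\<^bsub>M\<^esub> y \<in> S"
  shows "y \<in> S"
  using assms submodule_add[OF assms(1) submodule_neg[OF assms(1,2)] assms(4)]
  by (simp add: M.r_neg1 submodule_carrier)

lemma minus_eq_zero_iff:
  assumes "x \<in> carrier M" "y \<in> carrier M"
  shows "x \<ominus>\<^bsub>M\<^esub> y = \<zero>\<^bsub>M\<^esub> \<longleftrightarrow> x = y"
  using assms M.minus_equality[of x "\<ominus>\<^bsub>M\<^esub> y"] by (auto simp: a_minus_def M.r_neg)

lemma smult_zero_right [simp]:
  assumes "a \<in> carrier R"
  shows "a \<odot>\<^bsub>M\<^esub> \<zero>\<^bsub>M\<^esub> = \<zero>\<^bsub>M\<^esub>"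
  using assms smult_r_distr[of a "\<zero>\<^bsub>M\<^esub>" "\<zero>\<^bsub>M\<^esub>"]
    M.add.l_cancel_one[of "a \<odot>\<^bsub>M\<^esub> \<zero>\<^bsub>M\<^esub>" "a \<odot>\<^bsub>M\<^esub> \<zero>\<^bsub>M\<^esub>"] by simp

section \<open>Intersections and binary sums of submodules\<close>

lemma submodule_trivial: "submodule {\<zero>\<^bsub>M\<^esub>} R M"
  by (simp add: submodule_iff)

lemma submodule_whole: "submodule (carrier M) R M"
  by (simp add: submodule_iff)

lemma submodule_Int:
  assumes "submodule A R M" "submodule B R M"
  shows "submodule (A \<inter> B) R M"
  using assms unfolding submodule_iff by auto

lemma submodule_INT:
  assumes "\<And>i. i \<in> I \<Longrightarrow> submodule (A i) R M"
  shows "submodule (carrier M \<inter> (\<Inter>i\<in>I. A i)) R M"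
  using assms unfolding submodule_iff by auto

lemma submodule_neq_trivial:
  assumes "submodule A R M"
  shows "A \<noteq> {\<zero>\<^bsub>M\<^esub>} \<longleftrightarrow> (\<exists>x\<in>A. x \<noteq> \<zero>\<^bsub>M\<^esub>)"
  using assms submodule_zero by auto

lemma Int_eq_trivial_iff:
  assumes "submodule A R M" "submodule B R M"
  shows "A \<inter> B = {\<zero>\<^bsub>M\<^esub>} \<longleftrightarrow> (\<forall>x\<in>A. x \<in> B \<longrightarrow> x = \<zero>\<^bsub>M\<^esub>)"
  using assms submodule_zero by auto

lemma mem_set_add: "x \<in> A <+>\<^bsub>M\<^esub> B \<longleftrightarrow> (\<exists>a\<in>A. \<exists>b\<in>B. x = a \<oplus>\<^bsub>M\<^esub> b)"
  by (auto simp: set_add_def')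

lemma submodule_set_add:
  assumes A: "submodule A R M" and B: "submodule B R M"
  shows "submodule (A <+>\<^bsub>M\<^esub> B) R M"
  unfolding submodule_iff
proof (intro conjI ballI)
  show "A <+>\<^bsub>M\<^esub> B \<subseteq> carrier M"
    using submodule_subset[OF A] submodule_subset[OF B] by (intro M.set_add_closed)
  show "\<zero>\<^bsub>M\<^esub> \<in> A <+>\<^bsub>M\<^esub> B"
    unfolding mem_set_add
    by (intro bexI[OF _ submodule_zero[OF A]] bexI[OF _ submodule_zero[OF B]]) simp
next
  fix x y assume "x \<in> A <+>\<^bsub>M\<^esub> B" "y \<in> A <+>\<^bsub>M\<^esub> B"
  then obtain a b a' b' where *: "a \<in> A" "b \<in> B" "a' \<in> A" "b' \<in> B"
    and xy: "x = a \<oplus>\<^bsub>M\<^esub> b" "y = a' \<oplus>\<^bsub>M\<^esub> b'"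
    by (auto simp: mem_set_add)
  have "x \<oplus>\<^bsub>M\<^esub> y = (a \<oplus>\<^bsub>M\<^esub> a') \<oplus>\<^bsub>M\<^esub> (b \<oplus>\<^bsub>M\<^esub> b')"
  proof -
    have "a \<in> carrier M" "b \<in> carrier M" "a' \<in> carrier M" "b' \<in> carrier M"
      using * submodule_subset[OF A] submodule_subset[OF B] by auto
    then show ?thesis
      unfolding xy by (simp add: M.a_ac)
  qed
  then show "x \<oplus>\<^bsub>M\<^esub> y \<in> A <+>\<^bsub>M\<^esub> B"
    using submodule_add[OF A *(1,3)] submodule_add[OF B *(2,4)] by (auto simp: mem_set_add)
next
  fix r x assume r: "r \<in> carrier R" and "x \<in> A <+>\<^bsub>M\<^esub> B"
  then obtain a b where ab: "a \<in> A" "b \<in> B" "x = a \<oplus>\<^bsub>M\<^esub> b"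
    by (auto simp: mem_set_add)
  then have "r \<odot>\<^bsub>M\<^esub> x = r \<odot>\<^bsub>M\<^esub> a \<oplus>\<^bsub>M\<^esub> r \<odot>\<^bsub>M\<^esub> b"
    using r A B by (simp add: smult_r_distr submodule_carrier)
  then show "r \<odot>\<^bsub>M\<^esub> x \<in> A <+>\<^bsub>M\<^esub> B"
    using submodule_smult[OF A r ab(1)] submodule_smult[OF B r ab(2)] by (auto simp: mem_set_add)
qed

lemma set_add_upper:
  assumes "submodule A R M" "submodule B R M"
  shows "A \<subseteq> A <+>\<^bsub>M\<^esub> B" "B \<subseteq> A <+>\<^bsub>M\<^esub> B"
proof -
  have "a = a \<oplus>\<^bsub>M\<^esub> \<zero>\<^bsub>M\<^esub>" if "a \<in> A" for a
    using that assms by (simp add: submodule_carrier)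
  then show "A \<subseteq> A <+>\<^bsub>M\<^esub> B"
    using submodule_zero[OF assms(2)] unfolding mem_set_add subset_iff by blast
  have "b = \<zero>\<^bsub>M\<^esub> \<oplus>\<^bsub>M\<^esub> b" if "b \<in> B" for b
    using that assms by (simp add: submodule_carrier)
  then show "B \<subseteq> A <+>\<^bsub>M\<^esub> B"
    using submodule_zero[OF assms(1)] unfolding mem_set_add subset_iff by blast
qed

lemma set_add_least:
  assumes "submodule S R M" "A \<subseteq> S" "B \<subseteq> S"
  shows "A <+>\<^bsub>M\<^esub> B \<subseteq> S"
  using assms(2,3) submodule_add[OF assms(1)] unfolding mem_set_add subset_iff by blast

section \<open>Sums of families and direct sums\<close>

lemma submodule_submodule_sum:
  assumes "\<And>i. i \<in> I \<Longrightarrow> submodule (K i) R M"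
  shows "submodule (submodule_sum R M I K) R M"
proof -
  let ?\<S> = "{S. submodule S R M \<and> (\<forall>i\<in>I. K i \<subseteq> S)}"
  \<comment> \<open>Since \<open>carrier M\<close> is one of the submodules intersected, meeting
    with it changes nothing, and \<open>submodule_INT\<close> applies.\<close>
  have "carrier M \<in> ?\<S>"
    using assms submodule_whole submodule_subset by blast
  then have eq: "submodule_sum R M I K = carrier M \<inter> (\<Inter>S\<in>?\<S>. S)"
    unfolding submodule_sum_def image_ident by (simp only: Inf_lower inf.absorb2)
  show ?thesis
    unfolding eq by (rule submodule_INT) simp
qed

lemma submodule_sum_upper: "i \<in> I \<Longrightarrow> K i \<subseteq> submodule_sum R M I K"
  unfolding submodule_sum_def by blast

lemma submodule_sum_least:
  assumes "submodule S R M" "\<And>i. i \<in> I \<Longrightarrow> K i \<subseteq> S"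
  shows "submodule_sum R M I K \<subseteq> S"
  using assms unfolding submodule_sum_def by blast

lemma submodule_sum_mono:
  assumes "I \<subseteq> J"
  shows "submodule_sum R M I K \<subseteq> submodule_sum R M J K"
  using assms unfolding submodule_sum_def by blast

lemma submodule_sum_cong:
  assumes "\<And>i. i \<in> I \<Longrightarrow> K i = L i"
  shows "submodule_sum R M I K = submodule_sum R M I L"
  using assms unfolding submodule_sum_def by simp

lemma submodule_sum_insert:
  assumes "\<And>j. j \<in> insert i I \<Longrightarrow> submodule (K j) R M"
  shows "submodule_sum R M (insert i I) K = K i <+>\<^bsub>M\<^esub> submodule_sum R M I K"
proof
  have sub: "submodule (K i) R M" "submodule (submodule_sum R M I K) R M"
    using assms by (auto intro: submodule_submodule_sum)
  show "submodule_sum R M (insert i I) K \<subseteq> K i <+>\<^bsub>M\<^esub> submodule_sum R M I K"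
    using set_add_upper[OF sub] submodule_sum_upper[of _ I K]
    by (intro submodule_sum_least submodule_set_add sub) auto
  show "K i <+>\<^bsub>M\<^esub> submodule_sum R M I K \<subseteq> submodule_sum R M (insert i I) K"
    using assms
    by (intro set_add_least submodule_submodule_sum submodule_sum_upper submodule_sum_mono) auto
qed

lemma submodule_sum_empty: "submodule_sum R M {} K = {\<zero>\<^bsub>M\<^esub>}"
  using submodule_sum_least[OF submodule_trivial, of "{}" K]
    submodule_zero[OF submodule_submodule_sum, of "{}" K] by auto

lemma direct_sum_family_submodule:
  "direct_sum_family R M I K \<Longrightarrow> i \<in> I \<Longrightarrow> submodule (K i) R M"
  by (simp add: direct_sum_family_def)

lemma direct_sum_family_Int:
  "direct_sum_family R M I K \<Longrightarrow> i \<in> I \<Longrightarrow>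
    K i \<inter> submodule_sum R M (I - {i}) K = {\<zero>\<^bsub>M\<^esub>}"
  by (simp add: direct_sum_family_def)

text \<open>Only summands i \<noteq> k need an argument. If x = a + p lies in \<open>F i\<close>,
  with a in \<open>A\<close> and p in the sum of the members other than i and k, then a = x - p lies
  in the sum avoiding k. Hence a = 0, and x = p vanishes by directness of \<open>F\<close>.\<close>

lemma direct_sum_family_exchange:
  assumes F: "direct_sum_family R M I F" and k: "k \<in> I" and A: "submodule A R M"
    and AF: "A \<inter> submodule_sum R M (I - {k}) F = {\<zero>\<^bsub>M\<^esub>}"
  shows "direct_sum_family R M I (F(k := A))"
  unfolding direct_sum_family_def
proof (intro conjI ballI)
  let ?F = "F(k := A)"
  note sub = direct_sum_family_submodule[OF F]
  show sub': "submodule (?F i) R M" if "i \<in> I" for i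
    using that sub A by simp
  show "?F i \<inter> submodule_sum R M (I - {i}) ?F = {\<zero>\<^bsub>M\<^esub>}" if i: "i \<in> I" for i
  proof (cases "i = k")
    case True
    have "submodule_sum R M (I - {k}) ?F = submodule_sum R M (I - {k}) F"
      by (rule submodule_sum_cong) simp
    then show ?thesis
      using True AF by simp
  next
    case False
    let ?P = "submodule_sum R M (I - {i, k}) F"
    have P: "submodule ?P R M"
      using sub by (intro submodule_submodule_sum) auto
    have "I - {i} = insert k (I - {i, k})" "I - {k} = insert i (I - {i, k})"
      using False i k by auto
    then have sum_i: "submodule_sum R M (I - {i}) ?F = ?F k <+>\<^bsub>M\<^esub> submodule_sum R M (I - {i, k}) ?F"
      and sum_k: "submodule_sum R M (I - {k}) F = F i <+>\<^bsub>M\<^esub> ?P"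
      using sub sub' i k by (auto intro!: submodule_sum_insert simp del: fun_upd_apply)
    have P_eq: "submodule_sum R M (I - {i, k}) ?F = ?P"
      by (rule submodule_sum_cong) simp
    have "x = \<zero>\<^bsub>M\<^esub>" if x: "x \<in> F i" "x \<in> A <+>\<^bsub>M\<^esub> ?P" for x
    proof -
      obtain a p where ap: "a \<in> A" "p \<in> ?P" "x = a \<oplus>\<^bsub>M\<^esub> p"
        using x by (auto simp: mem_set_add)
      have carr: "a \<in> carrier M" "p \<in> carrier M" "x \<in> carrier M"
        using ap x A P sub[OF i] by (auto intro: submodule_carrier)
      have "a = x \<oplus>\<^bsub>M\<^esub> \<ominus>\<^bsub>M\<^esub> p"
        using ap carr by (simp add: M.a_assoc M.r_neg)
      then have "a \<in> F i <+>\<^bsub>M\<^esub> ?P"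
        using x submodule_neg[OF P ap(2)] by (auto simp: mem_set_add)
      then have "a = \<zero>\<^bsub>M\<^esub>"
        using AF ap sum_k by blast
      then have "x \<in> ?P"
        using ap carr by simp
      then have "x \<in> submodule_sum R M (I - {i}) F"
        using submodule_sum_mono[of "I - {i, k}" "I - {i}" F] by blast
      then show ?thesis
        using F i x unfolding direct_sum_family_def by blast
    qed
    then show ?thesis
      using False sub[OF i] A P sum_i P_eq
      by (simp add: Int_eq_trivial_iff submodule_set_add)
  qed
qed

section \<open>Essential submodules\<close>

lemma essential_Int:
  assumes A: "essential_submodule R M A" and B: "essential_submodule R M B"
  shows "essential_submodule R M (A \<inter> B)"
  unfolding essential_submodule_def
proof (intro conjI allI impI)
  show "submodule (A \<inter> B) R M"
    using A B submodule_Int unfolding essential_submodule_def by blast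
  fix L assume L: "submodule L R M \<and> L \<noteq> {\<zero>\<^bsub>M\<^esub>}"
  then have "submodule (B \<inter> L) R M \<and> B \<inter> L \<noteq> {\<zero>\<^bsub>M\<^esub>}"
    using B submodule_Int unfolding essential_submodule_def by blast
  then have "A \<inter> (B \<inter> L) \<noteq> {\<zero>\<^bsub>M\<^esub>}"
    using A unfolding essential_submodule_def by blast
  then show "A \<inter> B \<inter> L \<noteq> {\<zero>\<^bsub>M\<^esub>}"
    by (simp add: Int_assoc)
qed

lemma essential_whole: "essential_submodule R M (carrier M)"
  using submodule_whole submodule_subset unfolding essential_submodule_def
  by (metis inf.absorb2)

lemma essential_INT:
  fixes n :: nat
  assumes "\<And>i. i < n \<Longrightarrow> essential_submodule R M (A i)"
  shows "essential_submodule R M (carrier M \<inter> (\<Inter>i<n. A i))"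
  using assms
proof (induction n)
  case 0
  then show ?case
    by (simp add: essential_whole)
next
  case (Suc n)
  have "carrier M \<inter> (\<Inter>i<Suc n. A i) = (carrier M \<inter> (\<Inter>i<n. A i)) \<inter> A n"
    by (auto simp: lessThan_Suc)
  then show ?case
    using Suc by (simp add: essential_Int)
qed

lemma essential_mono:
  assumes "essential_submodule R M A" "submodule B R M" "A \<subseteq> B"
  shows "essential_submodule R M B"
proof -
  have "B \<inter> L \<noteq> {\<zero>\<^bsub>M\<^esub>}" if L: "submodule L R M" "L \<noteq> {\<zero>\<^bsub>M\<^esub>}" for L
  proof -
    have "A \<inter> L \<noteq> {\<zero>\<^bsub>M\<^esub>}" "submodule (A \<inter> L) R M"
      using assms L submodule_Int unfolding essential_submodule_def by auto
    then show ?thesis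
      using \<open>A \<subseteq> B\<close> submodule_neq_trivial by blast
  qed
  then show ?thesis
    using assms unfolding essential_submodule_def by blast
qed

end

subsection \<open>Meet-irreducible submodules\<close>

text \<open>This expresses uniformity of \<open>M/D\<close> inside the lattice of submodules of
  \<open>M\<close>, without cosets; \<open>uniform_factor_module_iff\<close> confirms it. The
  properness of \<open>D\<close> corresponds to \<open>M/D\<close> being nonzero.\<close>

definition meet_irreducible ::
    "('a, 'r) ring_scheme \<Rightarrow> ('a, 'b, 'm) module_scheme \<Rightarrow> 'b set \<Rightarrow> bool"
  where "meet_irreducible R M D \<longleftrightarrow>
    submodule D R M \<and> D \<noteq> carrier M \<and>
    (\<forall>A B. submodule A R M \<and> submodule B R M \<and> D \<subseteq> A \<and> D \<subseteq> B \<and> A \<inter> B = D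
       \<longrightarrow> A = D \<or> B = D)"

text \<open>
  Intersecting with the carrier takes care of the case \<open>n = 0\<close>, where the intersection of the
  family is the universal set.
\<close>

definition meet_decomposition ::
    "('a, 'r) ring_scheme \<Rightarrow> ('a, 'b, 'm) module_scheme \<Rightarrow> nat \<Rightarrow> (nat \<Rightarrow> 'b set) \<Rightarrow> bool"
  where "meet_decomposition R M n D \<longleftrightarrow>
    (\<forall>i<n. meet_irreducible R M (D i)) \<and> carrier M \<inter> (\<Inter>i<n. D i) = {\<zero>\<^bsub>M\<^esub>} \<and> n = udim R M"

text \<open>The relation resembles that of a basis to its dual basis: \<open>D i\<close> kills every
  \<open>U j\<close> except \<open>U i\<close>, on which it is injective. It is the common ground of
  both directions, as irredundant decompositions and families of complements each give rise to
  it.\<close>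

definition dual_families ::
    "('a, 'r) ring_scheme \<Rightarrow> ('a, 'b, 'm) module_scheme \<Rightarrow> nat \<Rightarrow>
      (nat \<Rightarrow> 'b set) \<Rightarrow> (nat \<Rightarrow> 'b set) \<Rightarrow> bool"
  where "dual_families R M n U D \<longleftrightarrow>
    (\<forall>i<n. submodule (U i) R M \<and> U i \<noteq> {\<zero>\<^bsub>M\<^esub>} \<and> U i \<inter> D i = {\<zero>\<^bsub>M\<^esub>} \<and>
       (\<forall>j<n. j \<noteq> i \<longrightarrow> U j \<subseteq> D i)) \<and>
    (\<forall>i<n. meet_irreducible R M (D i)) \<and>
    carrier M \<inter> (\<Inter>i<n. D i) = {\<zero>\<^bsub>M\<^esub>}"

context left_module
begin

lemma meet_irreducible_submodule: "meet_irreducible R M D \<Longrightarrow> submodule D R M"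
  by (simp add: meet_irreducible_def)

lemma uniform_module_iff: "uniform_module R M \<longleftrightarrow> meet_irreducible R M {\<zero>\<^bsub>M\<^esub>}"
  using submodule_trivial submodule_zero
  unfolding uniform_module_def meet_irreducible_def essential_submodule_def by blast

lemma submodule_of_submodule_iff:
  assumes "submodule U R M"
  shows "submodule L R (M\<lparr>carrier := U\<rparr>) \<longleftrightarrow> submodule L R M \<and> L \<subseteq> U"
proof -
  have U: "subgroup U (add_monoid M)"
    using assms by (rule submodule.axioms)
  have eq: "add_monoid (M\<lparr>carrier := U\<rparr>) = (add_monoid M)\<lparr>carrier := U\<rparr>"
    by simp
  have "subgroup L (add_monoid (M\<lparr>carrier := U\<rparr>)) \<longleftrightarrow> subgroup L (add_monoid M) \<and> L \<subseteq> U"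
    unfolding eq
    using group.incl_subgroup[OF M.a_group U] group.subgroup_incl[OF M.a_group _ U]
      subgroup.subset[of L "(add_monoid M)\<lparr>carrier := U\<rparr>"]
    by auto
  then show ?thesis
    unfolding submodule_def submodule_axioms_def by auto
qed

text \<open>Uniformity of \<open>U\<close> as a module of its own is restated through submodules of
  the ambient \<open>M\<close>, so that restricted records no longer occur.\<close>

lemma uniform_submodule_iff:
  "uniform_submodule R M U \<longleftrightarrow>
    submodule U R M \<and> U \<noteq> {\<zero>\<^bsub>M\<^esub>} \<and>
    (\<forall>A B. submodule A R M \<and> submodule B R M \<and> A \<subseteq> U \<and> B \<subseteq> U \<and> A \<inter> B = {\<zero>\<^bsub>M\<^esub>}
       \<longrightarrow> A = {\<zero>\<^bsub>M\<^esub>} \<or> B = {\<zero>\<^bsub>M\<^esub>})"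
proof (cases "submodule U R M")
  case True
  then show ?thesis
    unfolding uniform_submodule_def uniform_module_def essential_submodule_def
      submodule_of_submodule_iff[OF True]
    by (simp, blast)
qed (simp add: uniform_submodule_def)

section \<open>Uniform submodules and their complements\<close>

lemma uniform_Int_nontrivial:
  assumes U: "uniform_submodule R M U"
    and A: "submodule A R M" "A \<inter> U \<noteq> {\<zero>\<^bsub>M\<^esub>}" and B: "submodule B R M" "B \<inter> U \<noteq> {\<zero>\<^bsub>M\<^esub>}"
  shows "A \<inter> B \<inter> U \<noteq> {\<zero>\<^bsub>M\<^esub>}"
proof -
  have "submodule (A \<inter> U) R M" "submodule (B \<inter> U) R M"
    using U A B submodule_Int unfolding uniform_submodule_iff by auto
  moreover have "(A \<inter> U) \<inter> (B \<inter> U) = A \<inter> B \<inter> U"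
    by blast
  ultimately show ?thesis
    using U A B unfolding uniform_submodule_iff by (metis inf_le2)
qed

text \<open>Submodules \<open>A\<close> and \<open>B\<close> properly above \<open>D\<close> both
  meet \<open>U\<close> nontrivially, by maximality of \<open>D\<close>. Uniformity of
  \<open>U\<close> then makes A \<inter> B meet \<open>U\<close> nontrivially, so it cannot be
  \<open>D\<close>.\<close>

lemma complement_meet_irreducible:
  assumes U: "uniform_submodule R M U" and D: "complement_to R M U D"
  shows "meet_irreducible R M D"
  unfolding meet_irreducible_def
proof (intro conjI allI impI)
  have sub: "submodule D R M" "submodule U R M" and UD: "U \<inter> D = {\<zero>\<^bsub>M\<^esub>}" and U0: "U \<noteq> {\<zero>\<^bsub>M\<^esub>}"
    and max: "submodule C R M \<Longrightarrow> U \<inter> C = {\<zero>\<^bsub>M\<^esub>} \<Longrightarrow> D \<subseteq> C \<Longrightarrow> C = D" for C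
    using U D unfolding complement_to_def uniform_submodule_iff by auto
  show "submodule D R M"
    by (rule sub)
  show "D \<noteq> carrier M"
    using UD U0 submodule_subset[OF sub(2)] by blast
  fix A B assume AB: "submodule A R M \<and> submodule B R M \<and> D \<subseteq> A \<and> D \<subseteq> B \<and> A \<inter> B = D"
  show "A = D \<or> B = D"
  proof (rule ccontr)
    assume "\<not> (A = D \<or> B = D)"
    then have "A \<inter> U \<noteq> {\<zero>\<^bsub>M\<^esub>}" "B \<inter> U \<noteq> {\<zero>\<^bsub>M\<^esub>}"
      using AB max[of A] max[of B] by (auto simp: Int_commute)
    then have "A \<inter> B \<inter> U \<noteq> {\<zero>\<^bsub>M\<^esub>}"
      using U AB uniform_Int_nontrivial by blast
    then show False
      using AB UD by (simp add: Int_commute)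
  qed
qed

text \<open>Zorn's lemma, applied only to the candidates above \<open>X\<close>, so that the
  complement can be prescribed to contain \<open>X\<close>.\<close>

lemma complement_exists:
  assumes X: "submodule X R M" "U \<inter> X = {\<zero>\<^bsub>M\<^esub>}"
  obtains D where "complement_to R M U D" "X \<subseteq> D"
proof -
  let ?A = "{S. submodule S R M \<and> U \<inter> S = {\<zero>\<^bsub>M\<^esub>} \<and> X \<subseteq> S}"
  have "\<exists>D\<in>?A. \<forall>S\<in>?A. D \<subseteq> S \<longrightarrow> S = D"
  proof (rule subset_Zorn_nonempty)
    show "?A \<noteq> {}"
      using X by blast
    fix \<C> assume ne: "\<C> \<noteq> {}" and chain: "subset.chain ?A \<C>"
    have mem: "submodule S R M" "U \<inter> S = {\<zero>\<^bsub>M\<^esub>}" "X \<subseteq> S" if "S \<in> \<C>" for S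
      using chain that unfolding subset.chain_def by auto
    have tot: "S \<subseteq> T \<or> T \<subseteq> S" if "S \<in> \<C>" "T \<in> \<C>" for S T
      using chain that unfolding subset.chain_def by blast
    have "submodule (\<Union>\<C>) R M"
      unfolding submodule_iff
    proof (intro conjI ballI)
      show "\<Union>\<C> \<subseteq> carrier M"
        using submodule_subset[OF mem(1)] by blast
      show "\<zero>\<^bsub>M\<^esub> \<in> \<Union>\<C>"
        using submodule_zero[OF mem(1)] ne by blast
    next
      fix x y assume "x \<in> \<Union>\<C>" "y \<in> \<Union>\<C>"
      then obtain S where "S \<in> \<C>" "x \<in> S" "y \<in> S"
        using tot by blast
      then show "x \<oplus>\<^bsub>M\<^esub> y \<in> \<Union>\<C>"
        using submodule_add[OF mem(1)] by blast
    next
      fix a x assume "a \<in> carrier R" "x \<in> \<Union>\<C>"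
      then show "a \<odot>\<^bsub>M\<^esub> x \<in> \<Union>\<C>"
        using submodule_smult[OF mem(1)] by blast
    qed
    moreover have "U \<inter> \<Union>\<C> = {\<zero>\<^bsub>M\<^esub>}" "X \<subseteq> \<Union>\<C>"
      using mem(2,3) ne by blast+
    ultimately show "\<Union>\<C> \<in> ?A"
      by blast
  qed
  then obtain D where D: "submodule D R M" "U \<inter> D = {\<zero>\<^bsub>M\<^esub>}" "X \<subseteq> D"
    and max: "\<forall>S\<in>?A. D \<subseteq> S \<longrightarrow> S = D"
    by auto
  \<comment> \<open>Maximality among candidates above \<open>X\<close> is full maximality: a
    competitor containing \<open>D\<close> contains \<open>X\<close> as well.\<close>
  have "complement_to R M U D"
    unfolding complement_to_def using D max by (blast dest: order_trans)
  then show thesis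
    using that D by blast
qed

text \<open>The image of \<open>U\<close> in the uniform module \<open>M/D\<close> is nonzero, hence
  essential. Concretely, if \<open>L\<close> is not inside \<open>D\<close>, then U + D and L + D
  properly contain \<open>D\<close> and share some x = l + d outside \<open>D\<close>; this l is a
  nonzero element of \<open>L\<close> in U + D.\<close>

lemma essential_set_add_meet_irreducible:
  assumes D: "meet_irreducible R M D" and U: "submodule U R M" "U \<noteq> {\<zero>\<^bsub>M\<^esub>}" "U \<inter> D = {\<zero>\<^bsub>M\<^esub>}"
  shows "essential_submodule R M (U <+>\<^bsub>M\<^esub> D)"
  unfolding essential_submodule_def
proof (intro conjI allI impI)
  have D': "submodule D R M"
    using D by (rule meet_irreducible_submodule)
  show UD: "submodule (U <+>\<^bsub>M\<^esub> D) R M"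
    using U D' by (intro submodule_set_add)
  fix L assume "submodule L R M \<and> L \<noteq> {\<zero>\<^bsub>M\<^esub>}"
  then have L: "submodule L R M" "L \<noteq> {\<zero>\<^bsub>M\<^esub>}"
    by auto
  show "(U <+>\<^bsub>M\<^esub> D) \<inter> L \<noteq> {\<zero>\<^bsub>M\<^esub>}"
  proof (cases "L \<subseteq> D")
    case True
    then show ?thesis
      using L set_add_upper[OF U(1) D'] by blast
  next
    case False
    have LD: "submodule (L <+>\<^bsub>M\<^esub> D) R M"
      using L D' by (intro submodule_set_add)
    have "U <+>\<^bsub>M\<^esub> D \<noteq> D" "L <+>\<^bsub>M\<^esub> D \<noteq> D"
      using U L False set_add_upper[OF U(1) D'] set_add_upper[OF L(1) D'] by blast+
    then have "(U <+>\<^bsub>M\<^esub> D) \<inter> (L <+>\<^bsub>M\<^esub> D) \<noteq> D"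
      using D UD LD set_add_upper[OF U(1) D'] set_add_upper[OF L(1) D']
      unfolding meet_irreducible_def by blast
    then obtain x where x: "x \<in> U <+>\<^bsub>M\<^esub> D" "x \<in> L <+>\<^bsub>M\<^esub> D" "x \<notin> D"
      using set_add_upper[OF U(1) D'] set_add_upper[OF L(1) D'] by blast
    then obtain l d where ld: "l \<in> L" "d \<in> D" "x = l \<oplus>\<^bsub>M\<^esub> d"
      by (auto simp: mem_set_add)
    have carr: "l \<in> carrier M" "d \<in> carrier M"
      using ld submodule_subset[OF L(1)] submodule_subset[OF D'] by auto
    have "d \<in> U <+>\<^bsub>M\<^esub> D"
      using ld set_add_upper[OF U(1) D'] by blast
    moreover have "d \<oplus>\<^bsub>M\<^esub> l \<in> U <+>\<^bsub>M\<^esub> D"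
      using x ld carr by (simp add: M.a_comm)
    ultimately have "l \<in> U <+>\<^bsub>M\<^esub> D"
      using submodule_add_cancel[OF UD] carr by blast
    moreover have "l \<noteq> \<zero>\<^bsub>M\<^esub>"
      using x ld carr by auto
    ultimately show ?thesis
      using ld by blast
  qed
qed

section \<open>Dual families give essential direct sums\<close>

lemma dual_families_submodules:
  assumes "dual_families R M n U D"
  shows "\<And>i. i < n \<Longrightarrow> submodule (U i) R M" "\<And>i. i < n \<Longrightarrow> submodule (D i) R M"
  using assms meet_irreducible_submodule unfolding dual_families_def by auto

lemma dual_families_direct:
  assumes UD: "dual_families R M n U D"
  shows "direct_sum_family R M {..<n} U"
  unfolding direct_sum_family_def
proof (intro conjI ballI)
  note sub = dual_families_submodules[OF UD]
  fix i assume i: "i \<in> {..<n}"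
  show "submodule (U i) R M"
    using i sub by simp
  have "submodule_sum R M ({..<n} - {i}) U \<subseteq> D i"
    using UD i sub(2) unfolding dual_families_def by (intro submodule_sum_least) auto
  then have "U i \<inter> submodule_sum R M ({..<n} - {i}) U \<subseteq> {\<zero>\<^bsub>M\<^esub>}"
    using UD i unfolding dual_families_def by blast
  moreover have "submodule (submodule_sum R M ({..<n} - {i}) U) R M"
    using sub by (intro submodule_submodule_sum) auto
  ultimately show "U i \<inter> submodule_sum R M ({..<n} - {i}) U = {\<zero>\<^bsub>M\<^esub>}"
    using sub(1)[of i] i submodule_zero by blast
qed

text \<open>The sum contains the intersection of the finitely many essential submodules U i + D i.
  That inclusion is proved in the manner of the Chinese remainder theorem.\<close>

lemma dual_families_essential:
  assumes UD: "dual_families R M n U D"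
  shows "essential_submodule R M (submodule_sum R M {..<n} U)"
proof -
  note sub = dual_families_submodules[OF UD]
  let ?T = "\<lambda>k. submodule_sum R M {..<k} U"
  have T: "submodule (?T k) R M" if "k \<le> n" for k
    using that sub by (intro submodule_submodule_sum) auto
  have U_D: "U j \<subseteq> D i" if "i < n" "j < n" "j \<noteq> i" for i j
    using UD that unfolding dual_families_def by blast
  have "carrier M \<inter> (\<Inter>i<n. U i <+>\<^bsub>M\<^esub> D i) \<subseteq> ?T n"
  proof
    fix y assume "y \<in> carrier M \<inter> (\<Inter>i<n. U i <+>\<^bsub>M\<^esub> D i)"
    then have y: "y \<in> carrier M" and y_UD: "\<And>i. i < n \<Longrightarrow> y \<in> U i <+>\<^bsub>M\<^esub> D i"
      by auto
    \<comment> \<open>Successive approximation: t agrees with y modulo the first k of the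
      \<open>D i\<close>. For k = n the difference lies in every \<open>D i\<close> and is therefore
      zero.\<close>
    have "\<exists>t\<in>?T k. \<forall>i<k. y \<ominus>\<^bsub>M\<^esub> t \<in> D i" if "k \<le> n" for k
      using that
    proof (induction k)
      case 0
      then show ?case
        by (simp add: submodule_sum_empty)
    next
      case (Suc k)
      then obtain t where t: "t \<in> ?T k" "\<forall>i<k. y \<ominus>\<^bsub>M\<^esub> t \<in> D i"
        by auto
      obtain u d where ud: "u \<in> U k" "d \<in> D k" "y = u \<oplus>\<^bsub>M\<^esub> d"
        using y_UD[of k] Suc.prems by (auto simp: mem_set_add)
      \<comment> \<open>Only summands with index below k enter t, and all of them lie in
        \<open>D k\<close>.\<close>
      have tD: "t \<in> D k"
        using submodule_sum_least[of "D k" "{..<k}" U] U_D[of k] sub(2)[of k] t Suc.prems by force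
      have carr: "t \<in> carrier M" "u \<in> carrier M" "d \<in> carrier M"
        using t ud submodule_carrier[OF T[of k]] submodule_carrier[OF sub(1)[of k]]
          submodule_carrier[OF sub(2)[of k]] Suc.prems by auto
      have "t \<oplus>\<^bsub>M\<^esub> u \<in> ?T (Suc k)"
      proof (rule submodule_add[OF T])
        show "t \<in> ?T (Suc k)"
          using t submodule_sum_mono[of "{..<k}" "{..<Suc k}" U] by auto
        show "u \<in> ?T (Suc k)"
          using ud submodule_sum_upper[of k "{..<Suc k}" U] by auto
      qed (use Suc.prems in simp)
      moreover have "y \<ominus>\<^bsub>M\<^esub> (t \<oplus>\<^bsub>M\<^esub> u) \<in> D i" if "i < Suc k" for i
      proof (cases "i = k")
        case True
        have "y \<ominus>\<^bsub>M\<^esub> (t \<oplus>\<^bsub>M\<^esub> u) = d \<ominus>\<^bsub>M\<^esub> t"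
        proof -
          have "y \<ominus>\<^bsub>M\<^esub> (t \<oplus>\<^bsub>M\<^esub> u) = (d \<oplus>\<^bsub>M\<^esub> u) \<oplus>\<^bsub>M\<^esub> (\<ominus>\<^bsub>M\<^esub> u \<oplus>\<^bsub>M\<^esub> \<ominus>\<^bsub>M\<^esub> t)"
            using carr ud by (simp add: M.minus_add a_minus_def M.a_comm)
          also have "\<dots> = d \<oplus>\<^bsub>M\<^esub> (u \<oplus>\<^bsub>M\<^esub> (\<ominus>\<^bsub>M\<^esub> u \<oplus>\<^bsub>M\<^esub> \<ominus>\<^bsub>M\<^esub> t))"
            using carr by (simp add: M.a_assoc)
          finally show ?thesis
            using carr by (simp add: M.r_neg2 a_minus_def)
        qed
        then show ?thesis
          using True ud tD submodule_diff[OF sub(2)[of k]] Suc.prems by simp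
      next
        case False
        \<comment> \<open>The correction u lies in U k \<subseteq> D i, so the congruences already
          achieved survive.\<close>
        have "y \<ominus>\<^bsub>M\<^esub> (t \<oplus>\<^bsub>M\<^esub> u) = (y \<ominus>\<^bsub>M\<^esub> t) \<ominus>\<^bsub>M\<^esub> u"
          using carr ud by (simp add: M.minus_add a_minus_def M.a_ac)
        moreover have "u \<in> D i" "y \<ominus>\<^bsub>M\<^esub> t \<in> D i"
          using U_D[of i k] ud t that False Suc.prems by auto
        ultimately show ?thesis
          using submodule_diff[OF sub(2)[of i]] that Suc.prems by simp
      qed
      ultimately show ?case
        by blast
    qed
    then obtain t where t: "t \<in> ?T n" "\<forall>i<n. y \<ominus>\<^bsub>M\<^esub> t \<in> D i"
      by blast
    have carr: "y \<in> carrier M" "t \<in> carrier M"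
      using y t submodule_carrier[OF T[of n]] by auto
    then have "y \<ominus>\<^bsub>M\<^esub> t \<in> carrier M \<inter> (\<Inter>i<n. D i)"
      using t by auto
    then have "y \<ominus>\<^bsub>M\<^esub> t = \<zero>\<^bsub>M\<^esub>"
      using UD unfolding dual_families_def by blast
    then show "y \<in> ?T n"
      using carr t by (simp add: minus_eq_zero_iff)
  qed
  moreover have "essential_submodule R M (carrier M \<inter> (\<Inter>i<n. U i <+>\<^bsub>M\<^esub> D i))"
    using UD unfolding dual_families_def
    by (intro essential_INT essential_set_add_meet_irreducible) auto
  ultimately show ?thesis
    using T[of n] by (auto intro: essential_mono)
qed

end

subsection \<open>Uniform dimension and complements\<close>

context left_module
begin

lemma essential_uniform_sum_submodule:
  "essential_uniform_sum R M n U \<Longrightarrow> i < n \<Longrightarrow> submodule (U i) R M"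
  by (simp add: essential_uniform_sum_def uniform_submodule_def)

text \<open>Directness says that the sum of the other summands meets \<open>U i\<close> trivially,
  so a complement can be grown from that sum.\<close>

lemma direct_sum_complements_exist:
  assumes U: "direct_sum_family R M {..<n::nat} U"
  obtains D where "\<And>i. i < n \<Longrightarrow> complement_to R M (U i) (D i)"
    "\<And>i j. \<lbrakk>i < n; j < n; j \<noteq> i\<rbrakk> \<Longrightarrow> U j \<subseteq> D i"
proof -
  have "\<exists>D. complement_to R M (U i) D \<and> (\<forall>j<n. j \<noteq> i \<longrightarrow> U j \<subseteq> D)" if i: "i < n" for i
  proof -
    let ?X = "submodule_sum R M ({..<n} - {i}) U"
    have "submodule ?X R M" "U i \<inter> ?X = {\<zero>\<^bsub>M\<^esub>}"
      using U i by (auto simp: direct_sum_family_def intro!: submodule_submodule_sum)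
    then obtain D where D: "complement_to R M (U i) D" "?X \<subseteq> D"
      by (rule complement_exists)
    have "U j \<subseteq> D" if "j < n" "j \<noteq> i" for j
      using D(2) submodule_sum_upper[of j "{..<n} - {i}" U] that by auto
    then show ?thesis
      using D(1) by blast
  qed
  then have "\<forall>i. \<exists>D. i < n \<longrightarrow> complement_to R M (U i) D \<and> (\<forall>j<n. j \<noteq> i \<longrightarrow> U j \<subseteq> D)"
    by blast
  then obtain D where "\<forall>i. i < n \<longrightarrow> complement_to R M (U i) (D i) \<and> (\<forall>j<n. j \<noteq> i \<longrightarrow> U j \<subseteq> D i)"
    by (rule choice[THEN exE])
  then show thesis
    using that by blast
qed

text \<open>The point at issue is that the \<open>D i\<close> intersect in zero. Since the sum of
  the \<open>U i\<close> is essential, it suffices that this sum meets the intersection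
  trivially.\<close>

lemma dual_families_complements:
  assumes U: "essential_uniform_sum R M n U"
    and D: "\<And>i. i < n \<Longrightarrow> complement_to R M (U i) (D i)"
    and UD: "\<And>i j. \<lbrakk>i < n; j < n; j \<noteq> i\<rbrakk> \<Longrightarrow> U j \<subseteq> D i"
  shows "dual_families R M n U D"
proof -
  note U_sub = essential_uniform_sum_submodule[OF U]
  have D_sub: "submodule (D i) R M" and U_Int_D: "U i \<inter> D i = {\<zero>\<^bsub>M\<^esub>}" if "i < n" for i
    using D[OF that] unfolding complement_to_def by auto
  let ?T = "\<lambda>k. submodule_sum R M {k..<n} U"
  let ?X = "carrier M \<inter> (\<Inter>i<n. D i)"
  have T: "submodule (?T k) R M" for k
    using U_sub by (intro submodule_submodule_sum) auto
  have X: "submodule ?X R M"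
    using D_sub by (intro submodule_INT) auto
  \<comment> \<open>The components of x are stripped off from the front. The tail beyond k lies in
    \<open>D k\<close>, as does x, so the component in \<open>U k\<close> lies in U k \<inter> D k
    and is zero. At k = n the empty sum remains.\<close>
  have "x \<in> ?T k" if x: "x \<in> ?T 0" "x \<in> ?X" and "k \<le> n" for x k
    using \<open>k \<le> n\<close>
  proof (induction k)
    case 0
    then show ?case
      using x by simp
  next
    case (Suc k)
    then have k: "k < n"
      by simp
    then have "{k..<n} = insert k {Suc k..<n}"
      by auto
    then have "?T k = U k <+>\<^bsub>M\<^esub> ?T (Suc k)"
      using U_sub k by (auto intro!: submodule_sum_insert)
    then obtain u t where ut: "u \<in> U k" "t \<in> ?T (Suc k)" "x = u \<oplus>\<^bsub>M\<^esub> t"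
      using Suc by (auto simp: mem_set_add)
    have carr: "u \<in> carrier M" "t \<in> carrier M"
      using ut submodule_carrier[OF U_sub[OF k]] submodule_carrier[OF T] by auto
    have "?T (Suc k) \<subseteq> D k"
      using D_sub[OF k] UD[OF k] by (intro submodule_sum_least) auto
    then have "t \<in> D k" "t \<oplus>\<^bsub>M\<^esub> u \<in> D k"
      using ut x k carr by (auto simp: M.a_comm)
    then have "u \<in> D k"
      using submodule_add_cancel[OF D_sub[OF k]] carr by blast
    then have "u = \<zero>\<^bsub>M\<^esub>"
      using U_Int_D[OF k] ut by blast
    then show ?case
      using ut carr by simp
  qed
  from this[of _ n] have "?T 0 \<inter> ?X \<subseteq> {\<zero>\<^bsub>M\<^esub>}"
    by (auto simp: submodule_sum_empty)
  then have "?T 0 \<inter> ?X = {\<zero>\<^bsub>M\<^esub>}"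
    using submodule_zero[OF T[of 0]] submodule_zero[OF X] by blast
  moreover have "essential_submodule R M (?T 0)"
    using U unfolding essential_uniform_sum_def by (simp add: lessThan_atLeast0)
  ultimately have "?X = {\<zero>\<^bsub>M\<^esub>}"
    using X unfolding essential_submodule_def by blast
  moreover have unif: "uniform_submodule R M (U i)" if "i < n" for i
    using U that unfolding essential_uniform_sum_def by blast
  moreover have "meet_irreducible R M (D i)" "U i \<noteq> {\<zero>\<^bsub>M\<^esub>}" if "i < n" for i
    using complement_meet_irreducible[OF unif D, OF that that] unif[OF that]
    unfolding uniform_submodule_iff by auto
  ultimately show ?thesis
    unfolding dual_families_def using U_sub U_Int_D UD by (intro conjI allI impI) auto
qed

text \<open>Shrinking each \<open>U i\<close> to its nonzero intersection with \<open>W\<close>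
  keeps the family dual to the same complements. The shrunken sum is thus still essential, and it
  lies in \<open>W\<close>.\<close>

lemma essential_if_Int_uniform_nontrivial:
  assumes U: "essential_uniform_sum R M n U" and W: "submodule W R M"
    and UW: "\<And>i. i < n \<Longrightarrow> U i \<inter> W \<noteq> {\<zero>\<^bsub>M\<^esub>}"
  shows "essential_submodule R M W"
proof -
  note U_sub = essential_uniform_sum_submodule[OF U]
  have "direct_sum_family R M {..<n} U"
    using U unfolding essential_uniform_sum_def by blast
  then obtain D where D: "\<And>i. i < n \<Longrightarrow> complement_to R M (U i) (D i)"
    "\<And>i j. \<lbrakk>i < n; j < n; j \<noteq> i\<rbrakk> \<Longrightarrow> U j \<subseteq> D i"
    by (rule direct_sum_complements_exist) blast
  have dual: "dual_families R M n U D"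
    using U D by (rule dual_families_complements)
  have sub: "submodule (U i \<inter> W) R M" if "i < n" for i
    using U_sub[OF that] W by (rule submodule_Int)
  have "U i \<inter> W \<inter> D i = {\<zero>\<^bsub>M\<^esub>}" if "i < n" for i
  proof -
    have "U i \<inter> D i = {\<zero>\<^bsub>M\<^esub>}"
      using dual that unfolding dual_families_def by blast
    then show ?thesis
      using submodule_zero[OF W] by blast
  qed
  then have "dual_families R M n (\<lambda>i. U i \<inter> W) D"
    using sub UW D(2) dual unfolding dual_families_def by (simp add: le_infI1)
  then have "essential_submodule R M (submodule_sum R M {..<n} (\<lambda>i. U i \<inter> W))"
    by (rule dual_families_essential)
  moreover have "submodule_sum R M {..<n} (\<lambda>i. U i \<inter> W) \<subseteq> W"
    using W by (intro submodule_sum_least) auto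
  ultimately show ?thesis
    using W by (auto intro: essential_mono)
qed

text \<open>Steinitz exchange: the summands of \<open>V\<close> are replaced one at a time by summands of \<open>U\<close>.\<close>

lemma direct_sum_card_le:
  assumes U: "essential_uniform_sum R M n U" and V: "direct_sum_family R M {..<m::nat} V"
    and V0: "\<And>i. i < m \<Longrightarrow> V i \<noteq> {\<zero>\<^bsub>M\<^esub>}"
  shows "m \<le> n"
proof -
  \<comment> \<open>The family after k exchanges; \<open>f\<close> records which summand of
    \<open>U\<close> replaced each of the first k members.\<close>
  let ?F = "\<lambda>k f i. if i < k then U (f i) else V i"
  have "\<exists>f. (\<forall>i<k. f i < n) \<and> direct_sum_family R M {..<m} (?F k f)" if "k \<le> m" for k
    using that
  proof (induction k)
    case 0
    then show ?case
      using V by simp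
  next
    case (Suc k)
    then obtain f where f: "\<forall>i<k. f i < n" and F: "direct_sum_family R M {..<m} (?F k f)"
      by auto
    let ?W = "submodule_sum R M ({..<m} - {k}) (?F k f)"
    have W: "submodule ?W R M"
      by (rule submodule_submodule_sum) (use direct_sum_family_submodule[OF F] in blast)
    have "?F k f k \<inter> ?W = {\<zero>\<^bsub>M\<^esub>}"
      using Suc.prems by (intro direct_sum_family_Int[OF F]) simp
    then have VW: "?W \<inter> V k = {\<zero>\<^bsub>M\<^esub>}"
      by (simp add: Int_commute)
    have "submodule (V k) R M" "V k \<noteq> {\<zero>\<^bsub>M\<^esub>}"
      using V0 Suc.prems direct_sum_family_submodule[OF V, of k] by auto
    \<comment> \<open>The nonzero \<open>V k\<close> witnesses this. Were every \<open>U i\<close>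
      to meet \<open>?W\<close> nontrivially, \<open>?W\<close> would be essential; so some
      \<open>U i\<close> is free to replace \<open>V k\<close>.\<close>
    then have "\<not> essential_submodule R M ?W"
      using VW unfolding essential_submodule_def by blast
    then obtain i where i: "i < n" "U i \<inter> ?W = {\<zero>\<^bsub>M\<^esub>}"
      using essential_if_Int_uniform_nontrivial[OF U W] by blast
    have "direct_sum_family R M {..<m} ((?F k f)(k := U i))"
      using F Suc.prems i essential_uniform_sum_submodule[OF U]
      by (intro direct_sum_family_exchange) auto
    moreover have "(?F k f)(k := U i) = ?F (Suc k) (f(k := i))"
      by (auto simp: fun_eq_iff less_Suc_eq)
    ultimately have "direct_sum_family R M {..<m} (?F (Suc k) (f(k := i)))"
      by simp
    moreover have "\<forall>j<Suc k. (f(k := i)) j < n"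
      using f i by (auto simp: less_Suc_eq)
    ultimately show ?case
      by blast
  qed
  then obtain f where f: "\<forall>i<m. f i < n" and F: "direct_sum_family R M {..<m} (?F m f)"
    by blast
  \<comment> \<open>A repeated summand would lie in the sum of the others and hence be zero.\<close>
  have "inj_on f {..<m}"
  proof (rule inj_onI, rule ccontr)
    fix i j assume ij: "i \<in> {..<m}" "j \<in> {..<m}" "f i = f j" "i \<noteq> j"
    then have "U (f i) \<subseteq> submodule_sum R M ({..<m} - {i}) (?F m f)"
      using submodule_sum_upper[of j "{..<m} - {i}" "?F m f"] by auto
    then have "U (f i) = {\<zero>\<^bsub>M\<^esub>}"
      using direct_sum_family_Int[OF F ij(1)] ij(1) by auto
    then show False
      using U f ij unfolding essential_uniform_sum_def uniform_submodule_iff by auto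
  qed
  moreover have "f ` {..<m} \<subseteq> {..<n}"
    using f by auto
  ultimately show ?thesis
    using card_inj_on_le[of f "{..<m}" "{..<n}"] by simp
qed

text \<open>This justifies the definite description in \<open>udim\<close>: any two essential direct
  sums of uniform submodules have equally many summands, by the exchange bound applied in both
  directions.\<close>

lemma udim_eq:
  assumes U: "essential_uniform_sum R M n U"
  shows "udim R M = n"
proof -
  have le: "m \<le> n" if "essential_uniform_sum R M n U" "essential_uniform_sum R M m V" for m n U V
    using that by (intro direct_sum_card_le[OF that(1), of m V])
      (auto simp: essential_uniform_sum_def uniform_submodule_iff)
  show ?thesis
    unfolding udim_def
    by (rule the_equality) (use U le in \<open>blast intro: antisym\<close>)+
qed

text \<open>\<open>U\<close> embeds into the uniform module \<open>M/D\<close>. In elements: if A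
  \<inter> B = 0 inside \<open>U\<close>, then A + D and B + D intersect in \<open>D\<close>, so one
  of them equals \<open>D\<close>, which puts \<open>A\<close> or \<open>B\<close> into U \<inter> D
  = 0.\<close>

lemma uniform_if_Int_meet_irreducible_trivial:
  assumes D: "meet_irreducible R M D"
    and U: "submodule U R M" "U \<noteq> {\<zero>\<^bsub>M\<^esub>}" "U \<inter> D = {\<zero>\<^bsub>M\<^esub>}"
  shows "uniform_submodule R M U"
  unfolding uniform_submodule_iff
proof (intro conjI allI impI)
  fix A B
  assume AB: "submodule A R M \<and> submodule B R M \<and> A \<subseteq> U \<and> B \<subseteq> U \<and> A \<inter> B = {\<zero>\<^bsub>M\<^esub>}"
  then have A: "submodule A R M" "A \<subseteq> U" and B: "submodule B R M" "B \<subseteq> U"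
    by auto
  have D': "submodule D R M"
    using D by (rule meet_irreducible_submodule)
  note upper = set_add_upper[OF A(1) D'] set_add_upper[OF B(1) D']
  have "(A <+>\<^bsub>M\<^esub> D) \<inter> (B <+>\<^bsub>M\<^esub> D) \<subseteq> D"
  proof
    fix x assume "x \<in> (A <+>\<^bsub>M\<^esub> D) \<inter> (B <+>\<^bsub>M\<^esub> D)"
    then obtain a d b e where x: "a \<in> A" "d \<in> D" "x = a \<oplus>\<^bsub>M\<^esub> d"
      "b \<in> B" "e \<in> D" "x = b \<oplus>\<^bsub>M\<^esub> e"
      by (auto simp: mem_set_add)
    have carr: "a \<in> carrier M" "d \<in> carrier M" "b \<in> carrier M" "e \<in> carrier M"
      using x A B D' submodule_subset by blast+
    \<comment> \<open>Comparing a + d = b + e shows that a - b lies in U \<inter> D, so a = b lies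
      in A \<inter> B and vanishes.\<close>
    have "d \<oplus>\<^bsub>M\<^esub> (a \<ominus>\<^bsub>M\<^esub> b) = x \<ominus>\<^bsub>M\<^esub> b"
      using carr x(3) by (simp add: a_minus_def M.a_ac)
    also have "\<dots> = e"
      using carr x(6) by (simp add: a_minus_def M.a_comm[of b e] M.a_assoc M.r_neg)
    finally have "a \<ominus>\<^bsub>M\<^esub> b \<in> D"
      using submodule_add_cancel[OF D' x(2)] x(5) carr by simp
    moreover have "a \<ominus>\<^bsub>M\<^esub> b \<in> U"
      using submodule_diff[OF U(1)] x A B by blast
    ultimately have "a = b"
      using U(3) carr by (metis IntI minus_eq_zero_iff singletonD)
    then have "a = \<zero>\<^bsub>M\<^esub>"
      using AB x by blast
    then show "x \<in> D"
      using x carr by simp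
  qed
  then have "(A <+>\<^bsub>M\<^esub> D) \<inter> (B <+>\<^bsub>M\<^esub> D) = D"
    using upper by blast
  moreover have "submodule (A <+>\<^bsub>M\<^esub> D) R M" "submodule (B <+>\<^bsub>M\<^esub> D) R M"
    using A B D' by (auto intro: submodule_set_add)
  ultimately have "A <+>\<^bsub>M\<^esub> D = D \<or> B <+>\<^bsub>M\<^esub> D = D"
    using D upper unfolding meet_irreducible_def by blast
  then have "A \<subseteq> D \<or> B \<subseteq> D"
    using upper by blast
  then show "A = {\<zero>\<^bsub>M\<^esub>} \<or> B = {\<zero>\<^bsub>M\<^esub>}"
    using A B U(3) submodule_zero[OF A(1)] submodule_zero[OF B(1)] by blast
qed (use U in auto)

lemma dual_families_Int: "dual_families R M n U D \<Longrightarrow> i < n \<Longrightarrow> U i \<inter> D i = {\<zero>\<^bsub>M\<^esub>}"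
  by (simp add: dual_families_def)

lemma dual_families_essential_uniform_sum:
  assumes "dual_families R M n U D"
  shows "essential_uniform_sum R M n U"
  unfolding essential_uniform_sum_def
proof (intro conjI allI impI)
  fix i assume "i < n"
  then show "uniform_submodule R M (U i)"
    using assms unfolding dual_families_def
    by (intro uniform_if_Int_meet_irreducible_trivial[of "D i"]) auto
qed (use dual_families_direct[OF assms] dual_families_essential[OF assms] in auto)

text \<open>Intersecting all components but \<open>D i\<close> gives a submodule of every other
  \<open>D j\<close>, and it meets \<open>D i\<close> only in zero. Irredundancy is exactly what
  makes it nonzero.\<close>

lemma irredundant_dual_families:
  assumes D: "\<And>i. i < n \<Longrightarrow> meet_irreducible R M (D i)"
    and zero: "carrier M \<inter> (\<Inter>i<n. D i) = {\<zero>\<^bsub>M\<^esub>}"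
    and irr: "\<And>i. i < n \<Longrightarrow> carrier M \<inter> (\<Inter>j\<in>{..<n} - {i}. D j) \<noteq> {\<zero>\<^bsub>M\<^esub>}"
  shows "dual_families R M n (\<lambda>i. carrier M \<inter> (\<Inter>j\<in>{..<n} - {i}. D j)) D"
proof -
  have "submodule (carrier M \<inter> (\<Inter>j\<in>{..<n} - {i}. D j)) R M" for i
    using D meet_irreducible_submodule by (intro submodule_INT) auto
  moreover have "carrier M \<inter> (\<Inter>j\<in>{..<n} - {i}. D j) \<inter> D i = {\<zero>\<^bsub>M\<^esub>}" if "i < n" for i
  proof -
    have "carrier M \<inter> (\<Inter>j\<in>{..<n} - {i}. D j) \<inter> D i = carrier M \<inter> (\<Inter>j<n. D j)"
      using that by auto
    then show ?thesis
      using zero by simp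
  qed
  ultimately show ?thesis
    using D zero irr unfolding dual_families_def by auto
qed

text \<open>A subfamily of least size with zero intersection is irredundant, so its size is the
  uniform dimension n. It is therefore the whole family.\<close>

lemma udim_decomposition_irredundant:
  assumes D: "\<And>i. i < n \<Longrightarrow> meet_irreducible R M (D i)"
    and zero: "carrier M \<inter> (\<Inter>i<n. D i) = {\<zero>\<^bsub>M\<^esub>}"
    and n: "n = udim R M" and i: "i < n"
  shows "carrier M \<inter> (\<Inter>j\<in>{..<n} - {i}. D j) \<noteq> {\<zero>\<^bsub>M\<^esub>}"
proof -
  let ?P = "\<lambda>I. I \<subseteq> {..<n} \<and> carrier M \<inter> (\<Inter>j\<in>I. D j) = {\<zero>\<^bsub>M\<^esub>}"
  have "\<exists>I. ?P I \<and> (\<forall>J. ?P J \<longrightarrow> card I \<le> card J)"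
    using zero by (intro ex_has_least_nat[of ?P "{..<n}" card]) auto
  then obtain I where I: "I \<subseteq> {..<n}" "carrier M \<inter> (\<Inter>j\<in>I. D j) = {\<zero>\<^bsub>M\<^esub>}"
    and least: "\<And>J. ?P J \<Longrightarrow> card I \<le> card J"
    by blast
  have fin: "finite I"
    using I(1) finite_subset by blast
  have irr: "carrier M \<inter> (\<Inter>j\<in>I - {i}. D j) \<noteq> {\<zero>\<^bsub>M\<^esub>}" if "i \<in> I" for i
    using least[of "I - {i}"] card_Diff1_less[OF fin that] I(1) by force
  \<comment> \<open>Dual families are indexed by initial segments of the naturals, so
    \<open>I\<close> is renumbered.\<close>
  obtain h where h: "bij_betw h {..<card I} I"
    using ex_bij_betw_nat_finite[OF fin] by (auto simp: lessThan_atLeast0)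
  have img: "h ` ({..<card I} - {k}) = I - {h k}" if "k < card I" for k
    using h that unfolding bij_betw_def inj_on_def by auto
  have img': "h ` {..<card I} = I"
    using h by (simp add: bij_betw_def)
  have mem: "h k \<in> I" if "k < card I" for k
    using img' that by blast
  have INT_h: "(\<Inter>k\<in>K. D (h k)) = (\<Inter>j\<in>h ` K. D j)" for K
    by simp
  let ?U = "\<lambda>k. carrier M \<inter> (\<Inter>j\<in>{..<card I} - {k}. D (h j))"
  have "dual_families R M (card I) ?U (\<lambda>k. D (h k))"
  proof (rule irredundant_dual_families)
    show "meet_irreducible R M (D (h k))" if "k < card I" for k
      using D mem[OF that] I(1) by blast
    show "carrier M \<inter> (\<Inter>k<card I. D (h k)) = {\<zero>\<^bsub>M\<^esub>}"
      using I(2) by (simp only: INT_h img')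
    show "?U k \<noteq> {\<zero>\<^bsub>M\<^esub>}" if "k < card I" for k
      unfolding INT_h img[OF that] by (rule irr[OF mem[OF that]])
  qed
  then have "udim R M = card I"
    by (intro udim_eq dual_families_essential_uniform_sum)
  then have "I = {..<n}"
    using n I(1) by (intro card_subset_eq) auto
  then show ?thesis
    using irr i by simp
qed

lemma maximal_meet_decomposition_iff:
  "meet_decomposition R M n D \<and>
    (\<forall>D'. meet_decomposition R M n D' \<and> (\<forall>i<n. D i \<subseteq> D' i) \<longrightarrow> (\<forall>i<n. D i = D' i)) \<longleftrightarrow>
   (\<exists>U. essential_uniform_sum R M n U \<and>
     (\<forall>i<n. complement_to R M (U i) (D i) \<and> (\<forall>j<n. j \<noteq> i \<longrightarrow> U j \<subseteq> D i)))"
  (is "?lhs \<longleftrightarrow> ?rhs")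
proof
  assume lhs: ?lhs
  then have D: "\<And>i. i < n \<Longrightarrow> meet_irreducible R M (D i)"
    and zero: "carrier M \<inter> (\<Inter>i<n. D i) = {\<zero>\<^bsub>M\<^esub>}" and n: "n = udim R M"
    unfolding meet_decomposition_def by auto
  let ?U = "\<lambda>i. carrier M \<inter> (\<Inter>j\<in>{..<n} - {i}. D j)"
  have dual: "dual_families R M n ?U D"
    using D zero udim_decomposition_irredundant[OF D zero n] by (intro irredundant_dual_families)
  have U: "essential_uniform_sum R M n ?U"
    using dual by (rule dual_families_essential_uniform_sum)
  \<comment> \<open>Each component is enlarged to a complement. The enlarged family is again a
    decomposition of the same length, so maximality forces it to be \<open>D\<close> itself.\<close>
  have "\<exists>C. complement_to R M (?U i) C \<and> D i \<subseteq> C" if i: "i < n" for i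
    using complement_exists[OF dual_families_submodules(2)[OF dual i] dual_families_Int[OF dual i]]
    by metis
  then have "\<forall>i. \<exists>C. i < n \<longrightarrow> complement_to R M (?U i) C \<and> D i \<subseteq> C"
    by blast
  then obtain C where C: "\<forall>i. i < n \<longrightarrow> complement_to R M (?U i) (C i) \<and> D i \<subseteq> C i"
    by (rule choice[THEN exE])
  have U_D: "?U j \<subseteq> D i" if "i < n" "j < n" "j \<noteq> i" for i j
    using that by auto
  have "dual_families R M n ?U C"
    using U C U_D by (intro dual_families_complements) blast+
  then have "meet_decomposition R M n C"
    using n unfolding meet_decomposition_def dual_families_def by blast
  then have "\<forall>i<n. D i = C i"
    using lhs C by blast
  then show ?rhs
    using U C U_D by metis
next
  assume ?rhs
  then obtain U where U: "essential_uniform_sum R M n U"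
    and D: "\<And>i. i < n \<Longrightarrow> complement_to R M (U i) (D i)"
    and U_D: "\<And>i j. \<lbrakk>i < n; j < n; j \<noteq> i\<rbrakk> \<Longrightarrow> U j \<subseteq> D i"
    by blast
  have "dual_families R M n U D"
    using U D U_D by (rule dual_families_complements)
  then have "meet_decomposition R M n D"
    using udim_eq[OF U] unfolding meet_decomposition_def dual_families_def by blast
  moreover have "D i = D' i"
    if D': "meet_decomposition R M n D'" "\<forall>i<n. D i \<subseteq> D' i" and i: "i < n" for D' i
  proof -
    have sub: "submodule (D' i) R M" "submodule (U i) R M"
      using D' i essential_uniform_sum_submodule[OF U] meet_irreducible_submodule
      unfolding meet_decomposition_def by auto
    \<comment> \<open>For j \<noteq> i the submodule \<open>U i\<close> lies in D j \<subseteq> D'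
      j. So \<open>D' i\<close> meets \<open>U i\<close> trivially, and maximality of the complement
      \<open>D i\<close> rules out a proper enlargement.\<close>
    have "U i \<inter> D' i \<subseteq> carrier M \<inter> (\<Inter>j<n. D' j)"
    proof
      fix x assume x: "x \<in> U i \<inter> D' i"
      have "x \<in> D' j" if "j < n" for j
        using x U_D[OF that i] D'(2) that by (cases "j = i") auto
      then show "x \<in> carrier M \<inter> (\<Inter>j<n. D' j)"
        using x submodule_carrier[OF sub(1)] by auto
    qed
    then have "U i \<inter> D' i = {\<zero>\<^bsub>M\<^esub>}"
      using D'(1) submodule_zero[OF sub(1)] submodule_zero[OF sub(2)]
      unfolding meet_decomposition_def by blast
    then show ?thesis
      using D[OF i] sub D'(2) i unfolding complement_to_def by blast
  qed
  ultimately show ?lhs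
    by blast
qed

end

subsection \<open>Factor modules\<close>

locale factored_module = left_module R M
  for R :: "('a, 'r) ring_scheme" (structure) and M :: "('a, 'b, 'm) module_scheme" (structure) +
  fixes N
  assumes N: "submodule N R M"
begin

abbreviation Q where "Q \<equiv> factor_module M N"
abbreviation proj where "proj x \<equiv> N +>\<^bsub>M\<^esub> x"

lemma abelian_subgroup_submodule: "abelian_subgroup N M"
  using N M.abelian_group_axioms
  by (intro abelian_subgroupI3 additive_subgroupI submodule.axioms(1))

interpretation N: abelian_subgroup N M
  by (rule abelian_subgroup_submodule)

section \<open>The module structure on the cosets\<close>

lemma carrier_factor_module: "carrier Q = proj ` carrier M"
  by (auto simp: factor_module_def A_RCOSETS_def')

lemma proj_eq_iff:
  assumes "x \<in> carrier M" "y \<in> carrier M"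
  shows "proj x = proj y \<longleftrightarrow> x \<ominus>\<^bsub>M\<^esub> y \<in> N"
proof -
  have "proj x = proj y \<longleftrightarrow> x \<in> proj y"
    using assms M.a_repr_independence[OF _ assms(2) N.a_subgroup] N.a_rcos_self by metis
  then show ?thesis
    using N.a_rcos_module[OF assms(2,1)] by (simp add: a_minus_def)
qed

lemma proj_zero: "proj \<zero>\<^bsub>M\<^esub> = \<zero>\<^bsub>Q\<^esub>"
  using N.a_subset by (simp add: factor_module_def)

lemma proj_add:
  assumes "x \<in> carrier M" "y \<in> carrier M"
  shows "proj x \<oplus>\<^bsub>Q\<^esub> proj y = proj (x \<oplus>\<^bsub>M\<^esub> y)"
  using assms N.a_rcos_sum by (simp add: factor_module_def)

text \<open>The union defining the scalar action has only one distinct member: if y = h + x with h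
  in \<open>N\<close>, then a y and a x differ by a h, which lies in \<open>N\<close>.\<close>

lemma proj_smult:
  assumes "a \<in> carrier R" "x \<in> carrier M"
  shows "a \<odot>\<^bsub>Q\<^esub> proj x = proj (a \<odot>\<^bsub>M\<^esub> x)"
proof -
  have "proj (a \<odot>\<^bsub>M\<^esub> y) = proj (a \<odot>\<^bsub>M\<^esub> x)" if y: "y \<in> proj x" for y
  proof -
    obtain h where h: "h \<in> N" "y = h \<oplus>\<^bsub>M\<^esub> x"
      using y by (auto simp: a_r_coset_def')
    have carr: "h \<in> carrier M"
      using h N.a_subset by auto
    have ah: "a \<odot>\<^bsub>M\<^esub> h \<in> N"
      using submodule_smult[OF N assms(1) h(1)] .
    have "a \<odot>\<^bsub>M\<^esub> y = a \<odot>\<^bsub>M\<^esub> h \<oplus>\<^bsub>M\<^esub> a \<odot>\<^bsub>M\<^esub> x"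
      using h carr assms by (simp add: smult_r_distr)
    then have "a \<odot>\<^bsub>M\<^esub> y \<in> proj (a \<odot>\<^bsub>M\<^esub> x)"
      using ah by (auto simp: a_r_coset_def')
    then show ?thesis
      using assms M.a_repr_independence N.a_subgroup by (metis smult_closed)
  qed
  moreover have "x \<in> proj x"
    using assms N.a_rcos_self by simp
  ultimately have "(\<Union>y\<in>proj x. proj (a \<odot>\<^bsub>M\<^esub> y)) = proj (a \<odot>\<^bsub>M\<^esub> x)"
    by (intro SUP_eq_const) blast+
  then show ?thesis
    by (simp add: factor_module_def)
qed

lemma left_module_factor_module: "left_module R Q"
proof (intro left_module.intro left_module_axioms.intro)
  show "ring R"
    by (rule R.ring_axioms)
  show "abelian_group Q"
  proof (rule abelian_groupI)
    fix x assume "x \<in> carrier Q"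
    then obtain a where a: "a \<in> carrier M" "x = proj a"
      by (auto simp: carrier_factor_module)
    then have "proj (\<ominus>\<^bsub>M\<^esub> a) \<oplus>\<^bsub>Q\<^esub> x = \<zero>\<^bsub>Q\<^esub>"
      by (simp add: proj_add M.l_neg proj_zero)
    then show "\<exists>y\<in>carrier Q. y \<oplus>\<^bsub>Q\<^esub> x = \<zero>\<^bsub>Q\<^esub>"
      using a by (intro bexI[of _ "proj (\<ominus>\<^bsub>M\<^esub> a)"]) (auto simp: carrier_factor_module)
  qed (auto simp: carrier_factor_module proj_add M.a_ac simp flip: proj_zero)
qed (auto simp: carrier_factor_module proj_add proj_smult smult_l_distr smult_r_distr smult_assoc1)

interpretation Q: left_module R Q
  by (rule left_module_factor_module)

section \<open>The correspondence between submodules of the factor module and submodules above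
  \<open>N\<close>\<close>

definition preimage where "preimage S = {x \<in> carrier M. proj x \<in> S}"

lemma preimage_zero: "preimage {\<zero>\<^bsub>Q\<^esub>} = N"
proof -
  have "proj x = \<zero>\<^bsub>Q\<^esub> \<longleftrightarrow> x \<in> N" if "x \<in> carrier M" for x
    using M.a_coset_join1[OF _ that N.a_subgroup] M.a_coset_join2[OF that N.a_subgroup]
    by (auto simp: factor_module_def)
  then show ?thesis
    using N.a_subset by (auto simp: preimage_def)
qed

lemma preimage_carrier: "preimage (carrier Q) = carrier M"
  by (auto simp: preimage_def carrier_factor_module)

lemma submodule_preimage:
  assumes S: "submodule S R Q"
  shows "submodule (preimage S) R M"
  using Q.submodule_zero[OF S] Q.submodule_add[OF S] Q.submodule_smult[OF S]
  unfolding submodule_iff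
  by (auto simp: preimage_def proj_zero simp flip: proj_add proj_smult)

text \<open>Inclusions are reflected because every element of \<open>S\<close> is the coset of some
  element of \<open>M\<close>.\<close>

lemma preimage_subset_iff:
  assumes "submodule S R Q"
  shows "preimage S \<subseteq> preimage T \<longleftrightarrow> S \<subseteq> T"
  using Q.submodule_subset[OF assms] by (fastforce simp: preimage_def carrier_factor_module)

lemma preimage_eq_iff:
  assumes "submodule S R Q" "submodule T R Q"
  shows "preimage S = preimage T \<longleftrightarrow> S = T"
  using preimage_subset_iff assms by (metis subset_antisym order_refl)

text \<open>The witness is the image of \<open>C\<close> under \<open>proj\<close>. As
  \<open>C\<close> contains \<open>N\<close>, it is a union of cosets and is recovered from that
  image.\<close>

lemma preimage_exhaust:
  assumes C: "submodule C R M" "N \<subseteq> C"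
  obtains S where "submodule S R Q" "C = preimage S"
proof
  note carr = submodule_carrier[OF C(1)]
  show "submodule (proj ` C) R Q"
    unfolding Q.submodule_iff
  proof (intro conjI ballI)
    show "proj ` C \<subseteq> carrier Q"
      using carr by (auto simp: carrier_factor_module)
    show "\<zero>\<^bsub>Q\<^esub> \<in> proj ` C"
      using submodule_zero[OF C(1)] proj_zero by (metis imageI)
  next
    fix x y assume "x \<in> proj ` C" "y \<in> proj ` C"
    then show "x \<oplus>\<^bsub>Q\<^esub> y \<in> proj ` C"
      using carr submodule_add[OF C(1)] by (auto simp: proj_add)
  next
    fix a x assume "a \<in> carrier R" "x \<in> proj ` C"
    then show "a \<odot>\<^bsub>Q\<^esub> x \<in> proj ` C"
      using carr submodule_smult[OF C(1)] by (auto simp: proj_smult)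
  qed
  have "x \<in> C" if "x \<in> carrier M" "c \<in> C" "proj x = proj c" for x c
  proof -
    have "x \<ominus>\<^bsub>M\<^esub> c \<in> C"
      using that carr C(2) by (auto simp: proj_eq_iff)
    moreover have "c \<oplus>\<^bsub>M\<^esub> (x \<ominus>\<^bsub>M\<^esub> c) = x"
      using that carr by (simp add: a_minus_def M.a_lcomm[of c x] M.r_neg)
    ultimately show ?thesis
      using submodule_add[OF C(1) that(2)] by metis
  qed
  then show "C = preimage (proj ` C)"
    using carr by (auto simp: preimage_def)
qed

text \<open>Meet-irreducibility concerns only the submodules above the given one. All submodules of
  \<open>M\<close> above \<open>preimage S\<close> contain \<open>N\<close>, and there taking
  preimages is a lattice isomorphism.\<close>

lemma meet_irreducible_preimage_iff:
  assumes S: "submodule S R Q"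
  shows "meet_irreducible R M (preimage S) \<longleftrightarrow> meet_irreducible R Q S"
proof -
  have ne: "preimage S \<noteq> carrier M \<longleftrightarrow> S \<noteq> carrier Q"
    using preimage_eq_iff[OF S Q.submodule_whole] by (simp add: preimage_carrier)
  have Int: "preimage A \<inter> preimage B = preimage (A \<inter> B)" for A B
    by (auto simp: preimage_def)
  have N_S: "N \<subseteq> preimage S"
    using preimage_subset_iff[OF Q.submodule_trivial, of S] Q.submodule_zero[OF S]
    by (simp add: preimage_zero)
  show ?thesis
  proof
    assume irr: "meet_irreducible R M (preimage S)"
    have "A = S \<or> B = S"
      if AB: "submodule A R Q" "submodule B R Q" "S \<subseteq> A" "S \<subseteq> B" "A \<inter> B = S" for A B
    proof -
      have "preimage A = preimage S \<or> preimage B = preimage S"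
        using irr submodule_preimage[OF AB(1)] submodule_preimage[OF AB(2)] AB Int[of A B]
          preimage_subset_iff[OF S]
        unfolding meet_irreducible_def by simp
      then show ?thesis
        using AB S preimage_eq_iff by blast
    qed
    moreover have "S \<noteq> carrier Q"
      using irr ne unfolding meet_irreducible_def by blast
    ultimately show "meet_irreducible R Q S"
      using S unfolding meet_irreducible_def by (intro conjI allI impI) simp_all
  next
    assume irr: "meet_irreducible R Q S"
    have "A = preimage S \<or> B = preimage S"
      if AB: "submodule A R M" "submodule B R M" "preimage S \<subseteq> A" "preimage S \<subseteq> B"
        "A \<inter> B = preimage S" for A B
    proof -
      obtain A' B' where A': "submodule A' R Q" "A = preimage A'"
        and B': "submodule B' R Q" "B = preimage B'"
        using preimage_exhaust AB(1-4) N_S by (metis order_trans)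
      have "A' \<inter> B' = S"
        using preimage_eq_iff[OF Q.submodule_Int[OF A'(1) B'(1)] S] AB(5) A'(2) B'(2) Int by simp
      moreover have "S \<subseteq> A'" "S \<subseteq> B'"
        using AB(3,4) A'(2) B'(2) preimage_subset_iff[OF S] by auto
      ultimately have "A' = S \<or> B' = S"
        using irr A'(1) B'(1) unfolding meet_irreducible_def by blast
      then show ?thesis
        using A'(2) B'(2) by blast
    qed
    moreover have "preimage S \<noteq> carrier M"
      using irr ne unfolding meet_irreducible_def by blast
    ultimately show "meet_irreducible R M (preimage S)"
      using submodule_preimage[OF S] unfolding meet_irreducible_def
      by (intro conjI allI impI) simp_all
  qed
qed

lemma uniform_factor_module_iff: "uniform_module R Q \<longleftrightarrow> meet_irreducible R M N"
  using meet_irreducible_preimage_iff[OF Q.submodule_trivial]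
  by (simp add: preimage_zero Q.uniform_module_iff)

lemma shortest_uniform_decomposition_preimage_iff:
  assumes D: "\<And>i. i < n \<Longrightarrow> submodule (D i) R Q" and C: "\<And>i. i < n \<Longrightarrow> C i = preimage (D i)"
    and proper: "N \<noteq> carrier M"
  shows "shortest_uniform_decomposition R M N n C \<longleftrightarrow> meet_decomposition R Q n D"
proof -
  have irr: "submodule (C i) R M \<and> uniform_module R (factor_module M (C i)) \<longleftrightarrow>
      meet_irreducible R Q (D i)" if i: "i < n" for i
    \<comment> \<open>Two factor modules are involved: \<open>uniform_factor_module_iff\<close> is
      used for the one by \<open>C i\<close>, the correspondence for the one by
      \<open>N\<close>.\<close>
    using submodule_preimage[OF D[OF i]] meet_irreducible_preimage_iff[OF D[OF i]]
      factored_module.uniform_factor_module_iff[OF factored_module.intro,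
        OF left_module_axioms factored_module_axioms.intro]
    by (simp add: C[OF i])
  have sub: "submodule (carrier Q \<inter> (\<Inter>i<n. D i)) R Q"
    using D by (intro Q.submodule_INT) auto
  have "N = (\<Inter>i<n. C i) \<longleftrightarrow> carrier Q \<inter> (\<Inter>i<n. D i) = {\<zero>\<^bsub>Q\<^esub>}" if "1 \<le> n"
  proof -
    \<comment> \<open>For n = 0 the intersection of the \<open>C i\<close> would be the universal
      set rather than \<open>carrier M\<close>.\<close>
    have "0 < n"
      using that by simp
    then have "(\<Inter>i<n. C i) = preimage (carrier Q \<inter> (\<Inter>i<n. D i))"
      by (auto simp: C preimage_def carrier_factor_module)
    then show ?thesis
      using preimage_eq_iff[OF sub Q.submodule_trivial] by (auto simp: preimage_zero)
  qed
  \<comment> \<open>\<open>meet_decomposition\<close> imposes no lower bound on n; it follows here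
    because the empty intersection is all of \<open>Q\<close>, which is nonzero for proper
    \<open>N\<close>.\<close>
  moreover have "1 \<le> n" if "carrier Q \<inter> (\<Inter>i<n. D i) = {\<zero>\<^bsub>Q\<^esub>}"
  proof (rule ccontr)
    assume "\<not> 1 \<le> n"
    then have "n = 0"
      by simp
    then have "carrier Q = {\<zero>\<^bsub>Q\<^esub>}"
      using that by simp
    then show False
      using proper preimage_carrier preimage_zero by simp
  qed
  ultimately show ?thesis
    unfolding shortest_uniform_decomposition_def uniform_decomposition_def meet_decomposition_def
    using irr by metis
qed

text \<open>Every component contains the intersection \<open>N\<close>, so it is a preimage.\<close>

lemma shortest_uniform_decomposition_lift:
  assumes "shortest_uniform_decomposition R M N n C"
  obtains D where "\<And>i. i < n \<Longrightarrow> submodule (D i) R Q" "\<And>i. i < n \<Longrightarrow> C i = preimage (D i)"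
proof -
  have "\<exists>D. submodule D R Q \<and> C i = preimage D" if i: "i < n" for i
  proof -
    have sub: "submodule (C i) R M" and "N = (\<Inter>i<n. C i)"
      using assms i unfolding shortest_uniform_decomposition_def uniform_decomposition_def by blast+
    then have "N \<subseteq> C i"
      using i by blast
    with sub obtain D where "submodule D R Q" "C i = preimage D"
      by (rule preimage_exhaust)
    then show ?thesis
      by blast
  qed
  then have "\<forall>i. \<exists>D. i < n \<longrightarrow> submodule D R Q \<and> C i = preimage D"
    by blast
  then obtain D where "\<forall>i. i < n \<longrightarrow> submodule (D i) R Q \<and> C i = preimage (D i)"
    by (rule choice[THEN exE])
  then show thesis
    using that by blast
qed

text \<open>Maximality transfers because preimages preserve and reflect inclusion and because any
  competing decomposition of \<open>N\<close> also consists of preimages.\<close>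

lemma maximal_shortest_uniform_decomposition_iff:
  assumes proper: "N \<noteq> carrier M"
  shows "maximal_shortest_uniform_decomposition R M N n C \<longleftrightarrow>
    (\<exists>D. (\<forall>i<n. C i = preimage (D i)) \<and> meet_decomposition R Q n D \<and>
      (\<forall>D'. meet_decomposition R Q n D' \<and> (\<forall>i<n. D i \<subseteq> D' i) \<longrightarrow> (\<forall>i<n. D i = D' i)))"
  (is "?lhs \<longleftrightarrow> ?rhs")
proof
  note iff = shortest_uniform_decomposition_preimage_iff[OF _ _ proper]
  have sub: "submodule (D i) R Q" if "meet_decomposition R Q n D" "i < n" for D i
    using that Q.meet_irreducible_submodule unfolding meet_decomposition_def by blast
  assume ?lhs
  then have C: "shortest_uniform_decomposition R M N n C"
    and max: "\<And>C' i. shortest_uniform_decomposition R M N n C' \<Longrightarrow> \<forall>i<n. C i \<subseteq> C' i \<Longrightarrow>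
      i < n \<Longrightarrow> C i = C' i"
    unfolding maximal_shortest_uniform_decomposition_def by blast+
  obtain D where D: "\<And>i. i < n \<Longrightarrow> submodule (D i) R Q" "\<And>i. i < n \<Longrightarrow> C i = preimage (D i)"
    using C by (rule shortest_uniform_decomposition_lift) blast
  have "D i = D' i" if D': "meet_decomposition R Q n D'" "\<forall>i<n. D i \<subseteq> D' i" and i: "i < n" for D' i
  proof -
    have "shortest_uniform_decomposition R M N n (\<lambda>i. preimage (D' i))"
      using iff[of n D' "\<lambda>i. preimage (D' i)"] sub[OF D'(1)] D'(1) by simp
    moreover have "\<forall>i<n. C i \<subseteq> preimage (D' i)"
      using D D'(2) preimage_subset_iff by simp
    ultimately have "C i = preimage (D' i)"
      using max[of "\<lambda>i. preimage (D' i)"] i by blast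
    then show ?thesis
      using preimage_eq_iff[OF D(1)[OF i] sub[OF D'(1) i]] D(2)[OF i] by simp
  qed
  moreover have "meet_decomposition R Q n D"
    using iff[of n D C, OF D] C by blast
  ultimately show ?rhs
    using D(2) by blast
next
  note iff = shortest_uniform_decomposition_preimage_iff[OF _ _ proper]
  have sub: "submodule (D i) R Q" if "meet_decomposition R Q n D" "i < n" for D i
    using that Q.meet_irreducible_submodule unfolding meet_decomposition_def by blast
  assume ?rhs
  then obtain D where C: "\<forall>i<n. C i = preimage (D i)" and D: "meet_decomposition R Q n D"
    and max: "\<forall>D'. meet_decomposition R Q n D' \<and> (\<forall>i<n. D i \<subseteq> D' i) \<longrightarrow> (\<forall>i<n. D i = D' i)"
    by (elim exE conjE) (rule that)
  have "C i = C' i"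
    if C': "shortest_uniform_decomposition R M N n C'" "\<forall>i<n. C i \<subseteq> C' i" and i: "i < n" for C' i
  proof -
    obtain D' where D': "\<And>i. i < n \<Longrightarrow> submodule (D' i) R Q" "\<And>i. i < n \<Longrightarrow> C' i = preimage (D' i)"
      using C'(1) by (rule shortest_uniform_decomposition_lift) blast
    have "meet_decomposition R Q n D'"
      using iff[of n D' C', OF D'] C'(1) by blast
    moreover have "\<forall>i<n. D i \<subseteq> D' i"
      using C'(2) C D'(2) preimage_subset_iff[OF sub[OF D]] by simp
    ultimately have "D i = D' i"
      using max i by blast
    then show ?thesis
      using C i D'(2)[OF i] by simp
  qed
  moreover have "shortest_uniform_decomposition R M N n C"
    using iff[of n D C] sub[OF D] C D by blast
  ultimately show ?lhs
    unfolding maximal_shortest_uniform_decomposition_def by blast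
qed

end

theorem corollary6p6:
  fixes R :: "('a, 'r) ring_scheme" and M :: "('a, 'b, 'm) module_scheme"
    and N :: "'b set" and n :: nat and C :: "nat \<Rightarrow> 'b set"
  assumes "left_module R M"
    and "carrier M \<noteq> {\<zero>\<^bsub>M\<^esub>}"
    and "uniformly_finite R M"
    and "submodule N R M"
    and "N \<noteq> carrier M"
  defines "\<pi> \<equiv> (\<lambda>m. N +>\<^bsub>M\<^esub> m)"
  shows "maximal_shortest_uniform_decomposition R M N n C \<longleftrightarrow>
    (\<exists>U D.
       (\<forall>i<n. uniform_submodule R (factor_module M N) (U i)) \<and>
       direct_sum_family R (factor_module M N) {..<n} U \<and>
       essential_submodule R (factor_module M N)
         (submodule_sum R (factor_module M N) {..<n} U) \<and>
       (\<forall>i<n. complement_to R (factor_module M N) (U i) (D i) \<and>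
              (\<forall>j<n. j \<noteq> i \<longrightarrow> U j \<subseteq> D i)) \<and>
       (\<forall>i<n. C i = {m \<in> carrier M. \<pi> m \<in> D i}))"
proof -
  interpret factored_module R M N
    using \<open>left_module R M\<close> \<open>submodule N R M\<close>
    by (intro factored_module.intro factored_module_axioms.intro)
  interpret Q: left_module R "factor_module M N"
    by (rule left_module_factor_module)
  \<comment> \<open>After the two equivalences are combined, only the order of the existential
    quantifiers over \<open>U\<close> and \<open>D\<close> has to be changed.\<close>
  show ?thesis
    unfolding maximal_shortest_uniform_decomposition_iff[OF \<open>N \<noteq> carrier M\<close>]
      Q.maximal_meet_decomposition_iff essential_uniform_sum_def preimage_def \<pi>_def
    by blast
qed

end
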